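(* Let $\mathcal A$ be a unital $C^*$-algebra, $\mathcal L=\mathcal A_{\mathrm{sa}}$ regarded as a Lie--Jordan Banach algebra, $\mathcal J$ a closed Jordan ideal of $\mathcal L$, $\mathcal N_{\mathcal J}=\{a\in\mathcal L : [a,\mathcal J]\subset\mathcal J\}$, $\widetilde{\mathcal L}=\mathcal N_{\mathcal J}/(\mathcal N_{\mathcal J}\cap\mathcal J)$, and $\widetilde{\mathcal A}=\widetilde{\mathcal L}\oplus i\widetilde{\mathcal L}$ the corresponding $C^*$-algebra. Let $\widetilde\omega$ be a state on $\widetilde{\mathcal A}$, with GNS Hilbert space $\mathcal H_{\widetilde\omega}$. Let $\omega'$ be the state on $\mathcal N_{\mathcal J}^{\mathbb C}$ induced by $\widetilde\omega$, i.e. $\omega'$ is the composition of $\widetilde\omega$ with the quotient map $\mathcal N_{\mathcal J}^{\mathbb C}\to\widetilde{\mathcal A}$, let $\omega$ be a state on $\mathcal A$ extending $\omega'$, and let $\mathcal J_\omega$ be the Gelfand ideal of $\omega$. Then there is a unitary equivalence between $\mathcal H_{\widetilde\omega}$ and the completion of the pre-Hilbert space $$\mathcal H'=\frac{(\mathcal N_{\mathcal J}+\mathcal J)^{\mathbb C}}{(\mathcal N_{\mathcal J}+\mathcal J)^{\mathbb C}\cap\mathcal J_\omega}$$ with the inner product defined by $$\langle A+(\mathcal N_{\mathcal J}+\mathcal J)^{\mathbb C}\cap\mathcal J_\omega,\ B+(\mathcal N_{\mathcal J}+\mathcal J)^{\mathbb C}\cap\mathcal J_\omega\rangle'=\omega(A^*B),\qquad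 A,B\in(\mathcal N_{\mathcal J}+\mathcal J)^{\mathbb C}.$$
   Context: $\mathcal L=\mathcal A_{\mathrm{sa}}$ has Jordan product $a\circ b=\frac12(ab+ba)$, bracket $[a,b]=i\lambda(ab-ba)$ for a fixed nonzero $\lambda\in\mathbb R$, and the norm of $\mathcal A$. A Jordan ideal is a linear subspace $\mathcal J$ with $\mathcal L\circ\mathcal J\subset\mathcal J$. For a real subspace $X\subset\mathcal L$, $X^{\mathbb C}=X\oplus iX\subset\mathcal A$. $\mathcal N_{\mathcal J}^{\mathbb C}$ is a $C^*$-subalgebra of $\mathcal A$ and $\widetilde{\mathcal A}=\mathcal N_{\mathcal J}^{\mathbb C}/(\mathcal N_{\mathcal J}^{\mathbb C}\cap\mathcal J^{\mathbb C})$. For a state $\rho$ on a $C^*$-algebra $\mathcal B$ the Gelfand ideal is $\mathcal J_\rho=\{A\in\mathcal B:\rho(A^*A)=0\}$, and the GNS Hilbert space $\mathcal H_\rho$ is the completion of $\mathcal B/\mathcal J_\rho$ for the inner product $\langle A+\mathcal J_\rho,B+\mathcal J_\rho\rangle=\rho(A^*B)$. *)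

theory Defs
  imports "HOL-Analysis.Analysis"
begin

section \<open>Unital C*-algebras\<close>

text \<open>
  The sort \<open>real_normed_algebra_1\<close> contributes submultiplicativity and \<open>norm 1 = 1\<close>; the latter
  only excludes the zero algebra, which has no states.
\<close>

class unital_cstar_algebra = real_normed_algebra_1 + complete_space +
  fixes scaleC :: "complex \<Rightarrow> 'a \<Rightarrow> 'a"  (infixr \<open>*\<^sub>C\<close> 75)
    and adj :: "'a \<Rightarrow> 'a"
  assumes scaleC_add_right: "c *\<^sub>C (x + y) = c *\<^sub>C x + c *\<^sub>C y"
    and scaleC_add_left: "(c + d) *\<^sub>C x = c *\<^sub>C x + d *\<^sub>C x"
    and scaleC_scaleC: "c *\<^sub>C d *\<^sub>C x = (c * d) *\<^sub>C x"
    and scaleR_scaleC: "r *\<^sub>R x = complex_of_real r *\<^sub>C x"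
    and mult_scaleC_left: "(c *\<^sub>C x) * y = c *\<^sub>C (x * y)"
    and mult_scaleC_right: "x * (c *\<^sub>C y) = c *\<^sub>C (x * y)"
    and norm_scaleC: "norm (c *\<^sub>C x) = cmod c * norm x"
    and adj_adj: "adj (adj x) = x"
    and adj_add: "adj (x + y) = adj x + adj y"
    and adj_scaleC: "adj (c *\<^sub>C x) = cnj c *\<^sub>C adj x"
    and adj_mult: "adj (x * y) = adj y * adj x"
    and cstar_identity: "norm (adj x * x) = (norm x)\<^sup>2"

definition selfadjoint :: "'a::unital_cstar_algebra set" where
  "selfadjoint = {a. adj a = a}"

definition jordan_prod :: "'a::unital_cstar_algebra \<Rightarrow> 'a \<Rightarrow> 'a" where
  "jordan_prod a b = (1/2) *\<^sub>R (a * b + b * a)"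

definition lie_bracket :: "real \<Rightarrow> 'a::unital_cstar_algebra \<Rightarrow> 'a \<Rightarrow> 'a" where
  "lie_bracket lam a b = (\<i> * complex_of_real lam) *\<^sub>C (a * b - b * a)"

definition jordan_ideal :: "'a::unital_cstar_algebra set \<Rightarrow> bool" where
  "jordan_ideal J \<longleftrightarrow> J \<subseteq> selfadjoint \<and> subspace J \<and>
     (\<forall>a\<in>selfadjoint. \<forall>b\<in>J. jordan_prod a b \<in> J)"

definition normalizer :: "real \<Rightarrow> 'a::unital_cstar_algebra set \<Rightarrow> 'a set" where
  "normalizer lam J = {a \<in> selfadjoint. \<forall>j\<in>J. lie_bracket lam a j \<in> J}"

definition complexification :: "'a::unital_cstar_algebra set \<Rightarrow> 'a set" where
  "complexification X = {a + \<i> *\<^sub>C b | a b. a \<in> X \<and> b \<in> X}"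


section \<open>Complex vector spaces, inner product spaces and C*-algebras on carrier sets\<close>

record 'v cspace =
  vcarrier :: "'v set"
  vadd :: "'v \<Rightarrow> 'v \<Rightarrow> 'v"
  vzero :: 'v
  vscale :: "complex \<Rightarrow> 'v \<Rightarrow> 'v"

record 'v ip_space = "'v cspace" +
  vip :: "'v \<Rightarrow> 'v \<Rightarrow> complex"

record 'v cstar = "'v cspace" +
  amult :: "'v \<Rightarrow> 'v \<Rightarrow> 'v"
  aone :: 'v
  aadj :: "'v \<Rightarrow> 'v"
  anorm :: "'v \<Rightarrow> real"

locale complex_space =
  fixes V :: "('v, 'm) cspace_scheme"
  assumes add_closed: "x \<in> vcarrier V \<Longrightarrow> y \<in> vcarrier V \<Longrightarrow> vadd V x y \<in> vcarrier V"
    and zero_closed: "vzero V \<in> vcarrier V"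
    and scale_closed: "x \<in> vcarrier V \<Longrightarrow> vscale V c x \<in> vcarrier V"
    and add_assoc: "x \<in> vcarrier V \<Longrightarrow> y \<in> vcarrier V \<Longrightarrow> z \<in> vcarrier V \<Longrightarrow>
          vadd V (vadd V x y) z = vadd V x (vadd V y z)"
    and add_commute: "x \<in> vcarrier V \<Longrightarrow> y \<in> vcarrier V \<Longrightarrow> vadd V x y = vadd V y x"
    and add_zero: "x \<in> vcarrier V \<Longrightarrow> vadd V x (vzero V) = x"
    and add_inverse: "x \<in> vcarrier V \<Longrightarrow> vadd V x (vscale V (-1) x) = vzero V"
    and scale_add_right: "x \<in> vcarrier V \<Longrightarrow> y \<in> vcarrier V \<Longrightarrow>
          vscale V c (vadd V x y) = vadd V (vscale V c x) (vscale V c y)"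
    and scale_add_left: "x \<in> vcarrier V \<Longrightarrow>
          vscale V (c + d) x = vadd V (vscale V c x) (vscale V d x)"
    and scale_scale: "x \<in> vcarrier V \<Longrightarrow> vscale V c (vscale V d x) = vscale V (c * d) x"
    and scale_one: "x \<in> vcarrier V \<Longrightarrow> vscale V 1 x = x"

text \<open>Inner products are antilinear in the first argument.\<close>

locale pre_hilbert_space = complex_space V
  for V :: "('v, 'm) ip_space_scheme" +
  assumes ip_cnj: "x \<in> vcarrier V \<Longrightarrow> y \<in> vcarrier V \<Longrightarrow> vip V y x = cnj (vip V x y)"
    and ip_add: "x \<in> vcarrier V \<Longrightarrow> y \<in> vcarrier V \<Longrightarrow> z \<in> vcarrier V \<Longrightarrow>
          vip V x (vadd V y z) = vip V x y + vip V x z"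
    and ip_scale: "x \<in> vcarrier V \<Longrightarrow> y \<in> vcarrier V \<Longrightarrow>
          vip V x (vscale V c y) = c * vip V x y"
    and ip_nonneg: "x \<in> vcarrier V \<Longrightarrow> vip V x x \<in> \<real>\<^sub>\<ge>\<^sub>0"
    and ip_definite: "x \<in> vcarrier V \<Longrightarrow> vip V x x = 0 \<Longrightarrow> x = vzero V"

text \<open>
  The distance is set to \<open>0\<close> off the carrier because the library locale \<open>Metric_space\<close> requires
  nonnegativity and symmetry on the whole type.
\<close>

definition ip_dist :: "('v, 'm) ip_space_scheme \<Rightarrow> 'v \<Rightarrow> 'v \<Rightarrow> real" where
  "ip_dist V x y =
     (if x \<in> vcarrier V \<and> y \<in> vcarrier V
      then sqrt (cmod (let z = vadd V x (vscale V (-1) y) in vip V z z)) else 0)"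

locale hilbert_space = pre_hilbert_space +
  assumes complete: "Metric_space.mcomplete (vcarrier V) (ip_dist V)"


section \<open>Quotients\<close>

definition coset :: "('v, 'm) cspace_scheme \<Rightarrow> 'v set \<Rightarrow> 'v \<Rightarrow> 'v set" where
  "coset V W x = {vadd V x w | w. w \<in> W}"

text \<open>
  On cosets the operations are the unions of the cosets of the results over all representatives,
  as in the library's quotient rings.
\<close>

definition quotient_space :: "('v, 'm) cspace_scheme \<Rightarrow> 'v set \<Rightarrow> 'v set cspace" where
  "quotient_space V W =
     \<lparr>vcarrier = coset V W ` vcarrier V,
      vadd = (\<lambda>X Y. \<Union>x\<in>X. \<Union>y\<in>Y. coset V W (vadd V x y)),
      vzero = coset V W (vzero V),
      vscale = (\<lambda>c X. \<Union>x\<in>X. coset V W (vscale V c x))\<rparr>"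

definition quotient_algebra :: "('v, 'm) cstar_scheme \<Rightarrow> 'v set \<Rightarrow> 'v set cstar" where
  "quotient_algebra B I =
     cspace.extend (quotient_space B I)
       (cstar.fields
         (\<lambda>X Y. \<Union>x\<in>X. \<Union>y\<in>Y. coset B I (amult B x y))
         (coset B I (aone B))
         (\<lambda>X. \<Union>x\<in>X. coset B I (aadj B x))
         (\<lambda>X. Inf (anorm B ` X)))"

text \<open>
  The inner product of two cosets is the common value of the form \<open>s\<close> on all pairs of
  representatives.
\<close>

definition quotient_ip_space ::
  "('v, 'm) cspace_scheme \<Rightarrow> 'v set \<Rightarrow> ('v \<Rightarrow> 'v \<Rightarrow> complex) \<Rightarrow> 'v set ip_space" where
  "quotient_ip_space V W s =
     cspace.extend (quotient_space V W)
       (ip_space.fields (\<lambda>X Y. THE z. \<forall>x\<in>X. \<forall>y\<in>Y. s x y = z))"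


section \<open>Completion and unitary equivalence\<close>

definition cauchy_space :: "('v, 'm) ip_space_scheme \<Rightarrow> (nat \<Rightarrow> 'v) cspace" where
  "cauchy_space V =
     \<lparr>vcarrier = {f. Metric_space.MCauchy (vcarrier V) (ip_dist V) f},
      vadd = (\<lambda>f g n. vadd V (f n) (g n)),
      vzero = (\<lambda>n. vzero V),
      vscale = (\<lambda>c f n. vscale V c (f n))\<rparr>"

definition null_seqs :: "('v, 'm) ip_space_scheme \<Rightarrow> (nat \<Rightarrow> 'v) set" where
  "null_seqs V = {f \<in> vcarrier (cauchy_space V). (\<lambda>n. ip_dist V (f n) (vzero V)) \<longlonglongrightarrow> 0}"

definition ip_completion :: "('v, 'm) ip_space_scheme \<Rightarrow> (nat \<Rightarrow> 'v) set ip_space" where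
  "ip_completion V =
     quotient_ip_space (cauchy_space V) (null_seqs V) (\<lambda>f g. lim (\<lambda>n. vip V (f n) (g n)))"

definition unitary_map ::
  "('v, 'm) ip_space_scheme \<Rightarrow> ('w, 'n) ip_space_scheme \<Rightarrow> ('v \<Rightarrow> 'w) \<Rightarrow> bool" where
  "unitary_map H K U \<longleftrightarrow> bij_betw U (vcarrier H) (vcarrier K) \<and>
     (\<forall>x\<in>vcarrier H. \<forall>y\<in>vcarrier H. U (vadd H x y) = vadd K (U x) (U y)) \<and>
     (\<forall>c. \<forall>x\<in>vcarrier H. U (vscale H c x) = vscale K c (U x)) \<and>
     (\<forall>x\<in>vcarrier H. \<forall>y\<in>vcarrier H. vip K (U x) (U y) = vip H x y)"

definition unitarily_equivalent ::
  "('v, 'm) ip_space_scheme \<Rightarrow> ('w, 'n) ip_space_scheme \<Rightarrow> bool" where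
  "unitarily_equivalent H K \<longleftrightarrow> hilbert_space H \<and> hilbert_space K \<and> (\<exists>U. unitary_map H K U)"


section \<open>States and the GNS space\<close>

text \<open>For unital C*-algebras, positive functionals of norm one are those with value one at the unit.\<close>

definition state :: "('b, 'm) cstar_scheme \<Rightarrow> ('b \<Rightarrow> complex) \<Rightarrow> bool" where
  "state B \<rho> \<longleftrightarrow>
     (\<forall>x\<in>vcarrier B. \<forall>y\<in>vcarrier B. \<rho> (vadd B x y) = \<rho> x + \<rho> y) \<and>
     (\<forall>c. \<forall>x\<in>vcarrier B. \<rho> (vscale B c x) = c * \<rho> x) \<and>
     (\<forall>x\<in>vcarrier B. \<rho> (amult B (aadj B x) x) \<in> \<real>\<^sub>\<ge>\<^sub>0) \<and>
     \<rho> (aone B) = 1"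

definition gelfand_ideal :: "('b, 'm) cstar_scheme \<Rightarrow> ('b \<Rightarrow> complex) \<Rightarrow> 'b set" where
  "gelfand_ideal B \<rho> = {x \<in> vcarrier B. \<rho> (amult B (aadj B x) x) = 0}"

definition gns_space ::
  "('b, 'm) cstar_scheme \<Rightarrow> ('b \<Rightarrow> complex) \<Rightarrow> (nat \<Rightarrow> 'b set) set ip_space" where
  "gns_space B \<rho> =
     ip_completion (quotient_ip_space B (gelfand_ideal B \<rho>) (\<lambda>x y. \<rho> (amult B (aadj B x) y)))"


section \<open>Reduction by a Jordan ideal\<close>

definition lin_sub :: "'a::unital_cstar_algebra set \<Rightarrow> 'a cspace" where
  "lin_sub S = \<lparr>vcarrier = S, vadd = (+), vzero = 0, vscale = scaleC\<rparr>"

definition cstar_sub :: "'a::unital_cstar_algebra set \<Rightarrow> 'a cstar" where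
  "cstar_sub S = cspace.extend (lin_sub S) (cstar.fields (*) 1 adj norm)"

definition normalizerC :: "real \<Rightarrow> 'a::unital_cstar_algebra set \<Rightarrow> 'a set" where
  "normalizerC lam J = complexification (normalizer lam J)"

definition reduced_ideal :: "real \<Rightarrow> 'a::unital_cstar_algebra set \<Rightarrow> 'a set" where
  "reduced_ideal lam J = normalizerC lam J \<inter> complexification J"

definition reduced_algebra :: "real \<Rightarrow> 'a::unital_cstar_algebra set \<Rightarrow> 'a set cstar" where
  "reduced_algebra lam J =
     quotient_algebra (cstar_sub (normalizerC lam J)) (reduced_ideal lam J)"

definition reduced_proj :: "real \<Rightarrow> 'a::unital_cstar_algebra set \<Rightarrow> 'a \<Rightarrow> 'a set" where
  "reduced_proj lam J = coset (cstar_sub (normalizerC lam J)) (reduced_ideal lam J)"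

text \<open>\<open>normalizer lam J + J\<close> is the elementwise sum of sets.\<close>

definition sumC :: "real \<Rightarrow> 'a::unital_cstar_algebra set \<Rightarrow> 'a set" where
  "sumC lam J = complexification (normalizer lam J + J)"

definition sum_null :: "real \<Rightarrow> 'a::unital_cstar_algebra set \<Rightarrow> ('a \<Rightarrow> complex) \<Rightarrow> 'a set" where
  "sum_null lam J \<omega> = sumC lam J \<inter> gelfand_ideal (cstar_sub UNIV) \<omega>"

definition sum_pre_hilbert ::
  "real \<Rightarrow> 'a::unital_cstar_algebra set \<Rightarrow> ('a \<Rightarrow> complex) \<Rightarrow> 'a set ip_space" where
  "sum_pre_hilbert lam J \<omega> =
     quotient_ip_space (lin_sub (sumC lam J)) (sum_null lam J \<omega>) (\<lambda>A B. \<omega> (adj A * B))"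

end

theory Submission
  imports Defs
begin

text \<open>
  For \<open>j \<in> J\<close> the square \<open>j\<^sup>2 = j \<circ> j\<close> lies in \<open>J\<close>, and it normalizes \<open>J\<close> because
  \<open>[j \<circ> j, k] = 2 j \<circ> [j, k]\<close> with \<open>[j, k]\<close> self-adjoint. Hence \<open>\<omega>(j\<^sup>2) = 0\<close>, since \<open>\<omega>\<close> factors
  through the quotient on \<open>N\<close> and so vanishes on \<open>N \<inter> J\<close>. Thus the complexification of \<open>J\<close> lies in
  the Gelfand ideal of \<open>\<omega>\<close>, and every element of the complexification of \<open>N + J\<close> is congruent to one
  of the complexification of \<open>N\<close>. The map sending the class of \<open>n\<close> in the GNS pre-Hilbert space of
  \<open>\<omega>t\<close> to the class of \<open>n\<close> in \<open>H'\<close> is then a surjective isometry, and it extends to the completions.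
\<close>

section \<open>Quotients of complex vector spaces\<close>

text \<open>The obstacle is that \<omega> is tied to \<omega>t only on \<open>NC\<close>, while
  nothing at hand places an element j of J in N, so \<omega> cannot be evaluated on j itself.
  Membership in the Gelfand ideal asks only about the square, and the square does lie in N. Passing
  from J to its complexification then uses Cauchy-Schwarz: a null vector is orthogonal to every
  vector, so the null vectors form a complex subspace. The GNS space before completion, H' and each
  completion are all quotients of a complex space with a positive semidefinite form by its null
  vectors; for a completion the space consists of Cauchy sequences and the form is a limit. One
  lemma therefore yields every unitary map: a form-preserving map that is onto modulo null vectors
  descends to the quotients, and it need be neither linear nor compatible with classes beforehand.
  Hence an arbitrary choice of representatives serves as the map out of \<open>R\<close>. The
  complexification of N is closed under products because ab is the Jordan product plus i times a
  real multiple of [a, b], and N is closed under both operations.\<close>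

context complex_space
begin

abbreviation vsub :: "'v \<Rightarrow> 'v \<Rightarrow> 'v" where
  "vsub x y \<equiv> vadd V x (vscale V (-1) y)"

lemmas closed_simps = add_closed zero_closed scale_closed

lemma add_left_commute:
  assumes "x \<in> vcarrier V" "y \<in> vcarrier V" "z \<in> vcarrier V"
  shows "vadd V x (vadd V y z) = vadd V y (vadd V x z)"
  by (metis add_assoc add_commute assms)

lemma scale_zero_left: "x \<in> vcarrier V \<Longrightarrow> vscale V 0 x = vzero V"
  using scale_add_left[of x 1 "-1"] by (simp add: scale_one add_inverse)

lemma scale_zero_right: "vscale V c (vzero V) = vzero V"
  using scale_scale[OF zero_closed, of c 0] by (simp add: scale_zero_left zero_closed)

lemma add_zero_left: "x \<in> vcarrier V \<Longrightarrow> vadd V (vzero V) x = x"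
  using add_commute add_zero zero_closed by metis

lemma add_sub_cancel:
  assumes "x \<in> vcarrier V" "y \<in> vcarrier V"
  shows "vadd V y (vsub x y) = x"
proof -
  have "vadd V y (vsub x y) = vadd V x (vsub y y)"
    using assms by (intro add_left_commute closed_simps)
  then show ?thesis using assms by (simp add: add_inverse add_zero)
qed

lemma sub_add_cancel:
  assumes "x \<in> vcarrier V" "y \<in> vcarrier V"
  shows "vsub (vadd V y x) y = x"
proof -
  have "vsub (vadd V y x) y = vadd V x (vsub y y)"
    using assms by (simp add: add_commute[of y x] add_assoc closed_simps)
  then show ?thesis using assms by (simp add: add_inverse add_zero)
qed

lemma sub_eq_zero_iff:
  assumes "x \<in> vcarrier V" "y \<in> vcarrier V"
  shows "vsub x y = vzero V \<longleftrightarrow> x = y"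
  by (metis add_inverse add_sub_cancel add_zero assms)

lemma sub_swap:
  assumes "x \<in> vcarrier V" "y \<in> vcarrier V"
  shows "vsub y x = vscale V (-1) (vsub x y)"
  using assms
  by (simp add: scale_add_right closed_simps scale_scale scale_one add_commute)

lemma sub_sub_add:
  assumes "x \<in> vcarrier V" "y \<in> vcarrier V" "z \<in> vcarrier V"
  shows "vadd V (vsub x y) (vsub y z) = vsub x z"
proof -
  have "vadd V (vsub x y) (vsub y z) = vadd V x (vsub (vadd V (vscale V (-1) y) y) z)"
    using assms by (simp add: add_assoc closed_simps)
  then show ?thesis
    using assms by (simp add: add_commute[of "vscale V (-1) y" y] closed_simps add_inverse add_zero_left)
qed

lemma add_sub_add:
  assumes "x \<in> vcarrier V" "y \<in> vcarrier V" "z \<in> vcarrier V" "w \<in> vcarrier V"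
  shows "vsub (vadd V x y) (vadd V z w) = vadd V (vsub x z) (vsub y w)"
  using assms by (simp add: scale_add_right closed_simps add_assoc add_left_commute[of y])

lemma scale_sub:
  assumes "x \<in> vcarrier V" "y \<in> vcarrier V"
  shows "vsub (vscale V c x) (vscale V c y) = vscale V c (vsub x y)"
  using assms by (simp add: scale_add_right closed_simps scale_scale)

end

text \<open>Moves the linear axioms between records that share their linear part but differ in
  further fields such as an inner product or a multiplication.\<close>

lemma complex_space_cong:
  assumes "complex_space V"
    and "vcarrier V' = vcarrier V" "vadd V' = vadd V" "vzero V' = vzero V" "vscale V' = vscale V"
  shows "complex_space V'"
  using assms(1) unfolding complex_space_def assms(2-5) .

locale complex_subspace = complex_space V for V :: "('v, 'm) cspace_scheme" +
  fixes W :: "'v set"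
  assumes sub_carrier: "W \<subseteq> vcarrier V"
    and sub_zero: "vzero V \<in> W"
    and sub_add: "x \<in> W \<Longrightarrow> y \<in> W \<Longrightarrow> vadd V x y \<in> W"
    and sub_scale: "x \<in> W \<Longrightarrow> vscale V c x \<in> W"
begin

lemma mem_cosetE:
  assumes "y \<in> coset V W x"
  obtains w where "w \<in> W" "w \<in> vcarrier V" "y = vadd V x w"
  using assms sub_carrier by (auto simp: coset_def)

lemma self_mem_coset: "x \<in> vcarrier V \<Longrightarrow> x \<in> coset V W x"
  using sub_zero add_zero by (force simp: coset_def)

lemma coset_subset: "x \<in> vcarrier V \<Longrightarrow> coset V W x \<subseteq> vcarrier V"
  using sub_carrier by (auto simp: coset_def intro: add_closed)

lemma coset_add_mem:
  assumes x: "x \<in> vcarrier V" and w: "w \<in> W"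
  shows "coset V W (vadd V x w) = coset V W x"
proof -
  have wV: "w \<in> vcarrier V" using w sub_carrier by auto
  have "vadd V (vadd V x w) u = vadd V x (vadd V w u)" if "u \<in> W" for u
    using that sub_carrier x wV by (auto intro: add_assoc)
  then have 1: "coset V W (vadd V x w) \<subseteq> coset V W x"
    using sub_add w by (fastforce simp: coset_def)
  have "vadd V x u = vadd V (vadd V x w) (vsub u w)" if "u \<in> W" for u
  proof -
    have uV: "u \<in> vcarrier V" using that sub_carrier by auto
    show ?thesis
      using add_sub_cancel[OF uV wV] add_assoc[of x w "vsub u w"] x uV wV
      by (simp add: closed_simps)
  qed
  then have 2: "coset V W x \<subseteq> coset V W (vadd V x w)"
    using sub_add[OF _ sub_scale[OF w]] by (fastforce simp: coset_def)
  from 1 2 show ?thesis by auto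
qed

lemma coset_eq_iff:
  assumes "x \<in> vcarrier V" "y \<in> vcarrier V"
  shows "coset V W x = coset V W y \<longleftrightarrow> vsub x y \<in> W"
proof
  assume "coset V W x = coset V W y"
  then have "x \<in> coset V W y" using self_mem_coset assms by auto
  then show "vsub x y \<in> W" by (metis mem_cosetE sub_add_cancel assms(2))
next
  assume "vsub x y \<in> W"
  then show "coset V W x = coset V W y"
    by (metis add_sub_cancel assms coset_add_mem)
qed

lemma coset_eqI: "x \<in> vcarrier V \<Longrightarrow> y \<in> coset V W x \<Longrightarrow> coset V W y = coset V W x"
  by (metis coset_add_mem mem_cosetE)

lemma coset_nonempty: "coset V W x \<noteq> {}"
  using sub_zero by (auto simp: coset_def)

text \<open>The sum of two cosets is a union over all pairs of representatives. Every pair gives the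
  same coset, and cosets are nonempty, so the union collapses to that one coset.\<close>

lemma quotient_add:
  assumes x: "x \<in> vcarrier V" and y: "y \<in> vcarrier V"
  shows "vadd (quotient_space V W) (coset V W x) (coset V W y) = coset V W (vadd V x y)"
proof -
  have "coset V W (vadd V x' y') = coset V W (vadd V x y)"
    if x': "x' \<in> coset V W x" and y': "y' \<in> coset V W y" for x' y'
  proof -
    have c: "x' \<in> vcarrier V" "y' \<in> vcarrier V" using x' y' coset_subset x y by blast+
    have "vsub x' x \<in> W" "vsub y' y \<in> W"
      using coset_eqI[OF x x'] coset_eqI[OF y y'] coset_eq_iff c x y by auto
    then have "vsub (vadd V x' y') (vadd V x y) \<in> W"
      using add_sub_add c x y sub_add by simp
    then show ?thesis using coset_eq_iff c x y add_closed by simp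
  qed
  then show ?thesis
    using coset_nonempty x y by (simp add: quotient_space_def)
qed

lemma quotient_scale:
  assumes x: "x \<in> vcarrier V"
  shows "vscale (quotient_space V W) c (coset V W x) = coset V W (vscale V c x)"
proof -
  have "coset V W (vscale V c x') = coset V W (vscale V c x)" if x': "x' \<in> coset V W x" for x'
  proof -
    have c: "x' \<in> vcarrier V" using x' coset_subset x by blast
    have "vsub x' x \<in> W" using coset_eqI[OF x x'] coset_eq_iff c x by auto
    then have "vsub (vscale V c x') (vscale V c x) \<in> W"
      using scale_sub c x sub_scale by simp
    then show ?thesis using coset_eq_iff c x scale_closed by simp
  qed
  then show ?thesis
    using coset_nonempty x by (simp add: quotient_space_def)
qed

lemma quotient_complex_space: "complex_space (quotient_space V W)"
proof -
  let ?Q = "quotient_space V W"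
  have car: "vcarrier ?Q = coset V W ` vcarrier V" and zero: "vzero ?Q = coset V W (vzero V)"
    by (simp_all add: quotient_space_def)
  show ?thesis
    by unfold_locales
      (auto simp: car zero quotient_add quotient_scale closed_simps add_assoc add_zero add_inverse
        scale_add_right scale_add_left scale_scale scale_one,
      simp_all add: add_commute)
qed

end

section \<open>Positive semidefinite forms\<close>

text \<open>Definiteness is left out so that one quotient construction covers the form of \<omega>t
  on \<open>R\<close>, the form of \<omega> on subspaces of the algebra, and the limit form on
  Cauchy sequences.\<close>

locale semi_inner_space = complex_space V for V :: "('v, 'm) cspace_scheme" +
  fixes s :: "'v \<Rightarrow> 'v \<Rightarrow> complex"
  assumes form_cnj: "x \<in> vcarrier V \<Longrightarrow> y \<in> vcarrier V \<Longrightarrow> s y x = cnj (s x y)"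
    and form_add: "x \<in> vcarrier V \<Longrightarrow> y \<in> vcarrier V \<Longrightarrow> z \<in> vcarrier V \<Longrightarrow>
          s x (vadd V y z) = s x y + s x z"
    and form_scale: "x \<in> vcarrier V \<Longrightarrow> y \<in> vcarrier V \<Longrightarrow> s x (vscale V c y) = c * s x y"
    and form_nonneg: "x \<in> vcarrier V \<Longrightarrow> s x x \<in> \<real>\<^sub>\<ge>\<^sub>0"
begin

definition null :: "'v set" where
  "null = {x \<in> vcarrier V. s x x = 0}"

definition seminorm :: "'v \<Rightarrow> real" where
  "seminorm x = sqrt (Re (s x x))"

lemma form_add_left:
  assumes "x \<in> vcarrier V" "y \<in> vcarrier V" "z \<in> vcarrier V"
  shows "s (vadd V x y) z = s x z + s y z"
proof -
  have "s (vadd V x y) z = cnj (s z (vadd V x y))" using assms by (intro form_cnj closed_simps)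
  also have "\<dots> = cnj (s z x) + cnj (s z y)" using assms by (simp add: form_add)
  finally show ?thesis using form_cnj[of z x] form_cnj[of z y] assms by simp
qed

lemma form_scale_left:
  assumes "x \<in> vcarrier V" "y \<in> vcarrier V"
  shows "s (vscale V c x) y = cnj c * s x y"
proof -
  have "s (vscale V c x) y = cnj (s y (vscale V c x))" using assms by (intro form_cnj closed_simps)
  then show ?thesis using form_cnj[of y x] assms by (simp add: form_scale)
qed

lemmas form_simps = form_add form_scale form_add_left form_scale_left closed_simps

lemma form_self:
  assumes "x \<in> vcarrier V"
  shows "Im (s x x) = 0" "0 \<le> Re (s x x)"
  using form_nonneg[OF assms] by (simp_all add: complex_nonneg_Reals_iff)

lemma cmod_form_self: "x \<in> vcarrier V \<Longrightarrow> cmod (s x x) = Re (s x x)"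
  using form_self[of x] by (simp add: cmod_eq_Re)

lemma form_comb:
  assumes "x \<in> vcarrier V" "y \<in> vcarrier V"
  shows "s (vadd V (vscale V t x) (vscale V u y)) (vadd V (vscale V t x) (vscale V u y))
    = cnj t * t * s x x + cnj t * u * s x y + cnj u * t * cnj (s x y) + cnj u * u * s y y"
  using assms form_cnj[of x y] by (simp add: form_simps algebra_simps)

lemma Cauchy_Schwarz_sq:
  assumes x: "x \<in> vcarrier V" and y: "y \<in> vcarrier V"
  shows "(cmod (s x y))\<^sup>2 \<le> Re (s x x) * Re (s y y)"
proof -
  define a b c where "a = Re (s x x)" "b = Re (s y y)" "c = s x y"
  have sa: "s x x = of_real a" and sb: "s y y = of_real b" and "0 \<le> a" and "0 \<le> b"
    using form_self[OF x] form_self[OF y] by (simp_all add: a_b_c_def complex_eq_iff)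
  have cc: "c * cnj c = of_real ((cmod c)\<^sup>2)" by (rule complex_norm_square[symmetric])
  \<comment> \<open>Positivity at t x - k (cnj c) y. The factor \<open>cnj c\<close> makes the cross
    terms real, and two free parameters are kept because b may vanish, which rules out the usual
    division by b.\<close>
  have pos: "0 \<le> t\<^sup>2 * a - 2 * t * k * (cmod c)\<^sup>2 + k\<^sup>2 * (cmod c)\<^sup>2 * b" for t k :: real
  proof -
    let ?t = "complex_of_real t" and ?u = "- (of_real k * cnj c)"
    let ?z = "vadd V (vscale V ?t x) (vscale V ?u y)"
    have "s ?z ?z = of_real (t\<^sup>2 * a) - 2 * of_real (t * k) * (c * cnj c)
        + of_real (k\<^sup>2 * b) * (c * cnj c)"
      unfolding form_comb[OF x y] sa sb a_b_c_def(3)[symmetric]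
      by (simp add: power2_eq_square algebra_simps)
    also have "\<dots> = of_real (t\<^sup>2 * a - 2 * t * k * (cmod c)\<^sup>2 + k\<^sup>2 * (cmod c)\<^sup>2 * b)"
      unfolding cc by (simp add: algebra_simps)
    finally have "Re (s ?z ?z) = t\<^sup>2 * a - 2 * t * k * (cmod c)\<^sup>2 + k\<^sup>2 * (cmod c)\<^sup>2 * b"
      by simp
    then show ?thesis using form_self(2)[of ?z] x y by (simp add: closed_simps)
  qed
  have "(cmod c)\<^sup>2 \<le> a * b"
  proof (cases "b = 0")
    case True
    have "(cmod c)\<^sup>2 = 0"
    proof (rule ccontr)
      assume q: "(cmod c)\<^sup>2 \<noteq> 0"
      \<comment> \<open>With b = 0 and t = 1 the bound reads 0 \<le> a - 2 k |c|^2; this k turns the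
        right-hand side into -1.\<close>
      then show False using pos[of 1 "(a + 1) / (2 * (cmod c)\<^sup>2)"] True by simp
    qed
    then show ?thesis using True by simp
  next
    case False
    \<comment> \<open>The quadratic expression at t = b and k = 1.\<close>
    have "0 \<le> b * (a * b - (cmod c)\<^sup>2)"
      using pos[of b 1] by (simp add: power2_eq_square algebra_simps)
    then show ?thesis using False \<open>0 \<le> b\<close> by (simp add: zero_le_mult_iff)
  qed
  then show ?thesis by (simp add: a_b_c_def)
qed

lemma seminorm_nonneg: "x \<in> vcarrier V \<Longrightarrow> 0 \<le> seminorm x"
  by (simp add: seminorm_def form_self)

lemma seminorm_sq: "x \<in> vcarrier V \<Longrightarrow> (seminorm x)\<^sup>2 = Re (s x x)"
  by (simp add: seminorm_def form_self)

lemma Cauchy_Schwarz: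
  assumes "x \<in> vcarrier V" "y \<in> vcarrier V"
  shows "cmod (s x y) \<le> seminorm x * seminorm y"
proof (rule power2_le_imp_le)
  show "(cmod (s x y))\<^sup>2 \<le> (seminorm x * seminorm y)\<^sup>2"
    using Cauchy_Schwarz_sq[OF assms] assms by (simp add: power_mult_distrib seminorm_sq)
qed (simp add: assms seminorm_nonneg)

lemma seminorm_add_sq:
  assumes "x \<in> vcarrier V" "y \<in> vcarrier V"
  shows "(seminorm (vadd V x y))\<^sup>2 = (seminorm x)\<^sup>2 + 2 * Re (s x y) + (seminorm y)\<^sup>2"
  using assms form_cnj[of x y] by (simp add: seminorm_sq form_simps)

lemma seminorm_triangle:
  assumes "x \<in> vcarrier V" "y \<in> vcarrier V"
  shows "seminorm (vadd V x y) \<le> seminorm x + seminorm y"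
proof (rule power2_le_imp_le)
  have "Re (s x y) \<le> seminorm x * seminorm y"
    using Cauchy_Schwarz[OF assms] complex_Re_le_cmod order_trans by blast
  then show "(seminorm (vadd V x y))\<^sup>2 \<le> (seminorm x + seminorm y)\<^sup>2"
    using seminorm_add_sq[OF assms] by (simp add: power2_sum)
qed (simp add: assms seminorm_nonneg)

lemma seminorm_scale:
  assumes "x \<in> vcarrier V"
  shows "seminorm (vscale V c x) = cmod c * seminorm x"
proof -
  have "s (vscale V c x) (vscale V c x) = of_real ((cmod c)\<^sup>2) * s x x"
    unfolding complex_norm_square using assms by (simp add: form_simps mult_ac)
  then show ?thesis by (simp add: seminorm_def real_sqrt_mult)
qed

lemma seminorm_eq_0_iff: "x \<in> vcarrier V \<Longrightarrow> seminorm x = 0 \<longleftrightarrow> x \<in> null"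
  using form_self[of x] by (auto simp: seminorm_def null_def complex_eq_iff)

lemma seminorm_sub_commute:
  "x \<in> vcarrier V \<Longrightarrow> y \<in> vcarrier V \<Longrightarrow> seminorm (vsub x y) = seminorm (vsub y x)"
  using sub_swap[of x y] seminorm_scale[of "vsub x y" "-1"] by (simp add: closed_simps)

lemma seminorm_sub_triangle:
  assumes "x \<in> vcarrier V" "y \<in> vcarrier V" "z \<in> vcarrier V"
  shows "seminorm (vsub x z) \<le> seminorm (vsub x y) + seminorm (vsub y z)"
  using seminorm_triangle[of "vsub x y" "vsub y z"] sub_sub_add assms by (simp add: closed_simps)

lemma seminorm_diff_le:
  assumes "x \<in> vcarrier V" "y \<in> vcarrier V"
  shows "\<bar>seminorm x - seminorm y\<bar> \<le> seminorm (vsub x y)"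
proof -
  have 1: "seminorm x \<le> seminorm y + seminorm (vsub x y)"
    if "x \<in> vcarrier V" "y \<in> vcarrier V" for x y
    using seminorm_triangle[of y "vsub x y"] add_sub_cancel that by (simp add: closed_simps)
  show ?thesis using 1[OF assms] 1[OF assms(2,1)] seminorm_sub_commute[OF assms] by simp
qed

text \<open>By Cauchy-Schwarz a null vector is orthogonal to everything. This is what makes the null
  vectors a subspace and the form independent of representatives.\<close>

lemma form_null:
  assumes "x \<in> null" "y \<in> vcarrier V"
  shows "s x y = 0" "s y x = 0"
proof -
  have x: "x \<in> vcarrier V" and "seminorm x = 0"
    using assms(1) seminorm_eq_0_iff[of x] by (simp_all add: null_def)
  then show "s x y = 0" using Cauchy_Schwarz[OF x assms(2)] by simp
  then show "s y x = 0" using form_cnj[OF x assms(2)] by simp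
qed

sublocale null: complex_subspace V null
proof unfold_locales
  show "null \<subseteq> vcarrier V" by (auto simp: null_def)
  show "vzero V \<in> null"
    using form_scale[OF zero_closed zero_closed, of 0]
    by (simp add: null_def closed_simps scale_zero_right)
  show "vadd V x y \<in> null" if "x \<in> null" "y \<in> null" for x y
    using that form_null[OF that(1), of y] form_null[OF that(1), of x] form_null[OF that(2), of y]
      form_null[OF that(2), of x] by (simp add: null_def form_simps)
  show "vscale V c x \<in> null" if "x \<in> null" for x c
    using that by (simp add: null_def form_simps)
qed

abbreviation hquot :: "'v set ip_space" where
  "hquot \<equiv> quotient_ip_space V null s"

abbreviation cls :: "'v \<Rightarrow> 'v set" where
  "cls \<equiv> coset V null"

lemma hquot_carrier: "vcarrier hquot = cls ` vcarrier V"
  and hquot_zero: "vzero hquot = cls (vzero V)"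
  by (simp_all add: quotient_ip_space_def cspace.defs ip_space.defs quotient_space_def)

lemma hquot_add:
  "x \<in> vcarrier V \<Longrightarrow> y \<in> vcarrier V \<Longrightarrow> vadd hquot (cls x) (cls y) = cls (vadd V x y)"
  using null.quotient_add by (simp add: quotient_ip_space_def cspace.defs ip_space.defs)

lemma hquot_scale:
  "x \<in> vcarrier V \<Longrightarrow> vscale hquot c (cls x) = cls (vscale V c x)"
  using null.quotient_scale by (simp add: quotient_ip_space_def cspace.defs ip_space.defs)

text \<open>Changing representatives adds null vectors, which contribute nothing to the form; since
  cosets are nonempty, the common value picked by \<open>THE\<close> is unique.\<close>

lemma hquot_ip:
  assumes x: "x \<in> vcarrier V" and y: "y \<in> vcarrier V"
  shows "vip hquot (cls x) (cls y) = s x y"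
proof -
  have "s x' y' = s x y" if x': "x' \<in> cls x" and y': "y' \<in> cls y" for x' y'
  proof -
    obtain w where w: "w \<in> null" "w \<in> vcarrier V" "x' = vadd V x w"
      using null.mem_cosetE[OF x'] .
    obtain u where u: "u \<in> null" "u \<in> vcarrier V" "y' = vadd V y u"
      using null.mem_cosetE[OF y'] .
    show ?thesis
      unfolding w(3) u(3) using x y w(2) u(2) form_null[OF w(1)] form_null[OF u(1) x]
      by (simp add: form_simps)
  qed
  then have "(THE z. \<forall>x'\<in>cls x. \<forall>y'\<in>cls y. s x' y' = z) = s x y"
    using null.self_mem_coset[OF x] null.self_mem_coset[OF y] by (intro the_equality) metis+
  then show ?thesis by (simp add: quotient_ip_space_def cspace.defs ip_space.defs)
qed

lemma cls_eq_iff: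
  "x \<in> vcarrier V \<Longrightarrow> y \<in> vcarrier V \<Longrightarrow> cls x = cls y \<longleftrightarrow> vsub x y \<in> null"
  by (rule null.coset_eq_iff)

lemma hquot_pre_hilbert: "pre_hilbert_space hquot"
proof -
  interpret Q: complex_space hquot
    by (rule complex_space_cong[OF null.quotient_complex_space])
      (simp_all add: quotient_ip_space_def cspace.defs ip_space.defs)
  show ?thesis
  proof unfold_locales
    fix X assume "X \<in> vcarrier hquot" "vip hquot X X = 0"
    then obtain x where x: "x \<in> vcarrier V" "X = cls x" "s x x = 0"
      by (auto simp: hquot_carrier hquot_ip)
    then have "x \<in> null" by (simp add: null_def)
    then show "X = vzero hquot"
      using x null.coset_add_mem[OF zero_closed, of x] by (simp add: hquot_zero add_zero_left)
  qed (auto simp: hquot_carrier hquot_ip hquot_add hquot_scale form_simps form_nonneg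
        intro: form_cnj)
qed

lemma hquot_dist:
  assumes "x \<in> vcarrier V" "y \<in> vcarrier V"
  shows "ip_dist hquot (cls x) (cls y) = seminorm (vsub x y)"
proof -
  have "cmod (s (vsub x y) (vsub x y)) = Re (s (vsub x y) (vsub x y))"
    using assms by (intro cmod_form_self closed_simps)
  then show ?thesis
    using assms by (simp add: ip_dist_def hquot_carrier hquot_scale hquot_add hquot_ip
        closed_simps seminorm_def Let_def)
qed

end

section \<open>Completions\<close>

context pre_hilbert_space
begin

sublocale semi_inner_space V "vip V"
  by unfold_locales (auto simp: ip_add ip_scale ip_nonneg intro: ip_cnj)

lemma dist_eq:
  assumes "x \<in> vcarrier V" "y \<in> vcarrier V"
  shows "ip_dist V x y = seminorm (vsub x y)"
proof -
  have "cmod (vip V (vsub x y) (vsub x y)) = Re (vip V (vsub x y) (vsub x y))"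
    using assms by (intro cmod_form_self closed_simps)
  then show ?thesis using assms by (simp add: ip_dist_def seminorm_def Let_def)
qed

lemma seminorm_eq_0: "x \<in> vcarrier V \<Longrightarrow> seminorm x = 0 \<longleftrightarrow> x = vzero V"
  using seminorm_eq_0_iff ip_definite null.sub_zero by (auto simp: null_def)

sublocale metric: Metric_space "vcarrier V" "ip_dist V"
proof
  show "0 \<le> ip_dist V x y" for x y by (simp add: ip_dist_def Let_def)
  show "ip_dist V x y = ip_dist V y x" for x y
  proof (cases "x \<in> vcarrier V \<and> y \<in> vcarrier V")
    case True
    then show ?thesis using seminorm_sub_commute by (simp add: dist_eq)
  qed (auto simp: ip_dist_def)
qed (auto simp: dist_eq closed_simps seminorm_eq_0 sub_eq_zero_iff seminorm_sub_triangle)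

abbreviation cauchy :: "(nat \<Rightarrow> 'v) cspace" where
  "cauchy \<equiv> cauchy_space V"

lemma cauchy_simps:
  "vadd cauchy f g = (\<lambda>n. vadd V (f n) (g n))"
  "vzero cauchy = (\<lambda>n. vzero V)"
  "vscale cauchy c f = (\<lambda>n. vscale V c (f n))"
  by (simp_all add: cauchy_space_def)

lemma mem_cauchy_iff:
  "f \<in> vcarrier cauchy \<longleftrightarrow> (\<forall>n. f n \<in> vcarrier V) \<and>
     (\<forall>e>0. \<exists>N. \<forall>m\<ge>N. \<forall>n\<ge>N. seminorm (vsub (f m) (f n)) < e)"
proof -
  have "f \<in> vcarrier cauchy \<longleftrightarrow> range f \<subseteq> vcarrier V \<and>
     (\<forall>e>0. \<exists>N. \<forall>m n. N \<le> m \<longrightarrow> N \<le> n \<longrightarrow> ip_dist V (f m) (f n) < e)"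
    by (simp add: cauchy_space_def metric.MCauchy_def)
  then show ?thesis by (auto simp: dist_eq image_subset_iff)
qed

lemma cauchy_mem: "f \<in> vcarrier cauchy \<Longrightarrow> f n \<in> vcarrier V"
  by (simp add: mem_cauchy_iff)

lemma cauchyD:
  assumes "f \<in> vcarrier cauchy" "e > 0"
  obtains N where "\<And>m n. m \<ge> N \<Longrightarrow> n \<ge> N \<Longrightarrow> seminorm (vsub (f m) (f n)) < e"
  using assms mem_cauchy_iff by metis

lemma cauchy_const: "x \<in> vcarrier V \<Longrightarrow> (\<lambda>n. x) \<in> vcarrier cauchy"
  using seminorm_eq_0[OF zero_closed] by (simp add: mem_cauchy_iff add_inverse)

lemma cauchy_complex_space: "complex_space cauchy"
proof
  fix f g assume f: "f \<in> vcarrier cauchy" and g: "g \<in> vcarrier cauchy"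
  note c = cauchy_mem[OF f] cauchy_mem[OF g]
  have "\<exists>N. \<forall>m\<ge>N. \<forall>n\<ge>N. seminorm (vsub (vadd V (f m) (g m)) (vadd V (f n) (g n))) < e"
    if e: "e > 0" for e
  proof -
    obtain M where M: "\<And>m n. m \<ge> M \<Longrightarrow> n \<ge> M \<Longrightarrow> seminorm (vsub (f m) (f n)) < e/2"
      using cauchyD[OF f, of "e/2"] e by auto
    obtain N where N: "\<And>m n. m \<ge> N \<Longrightarrow> n \<ge> N \<Longrightarrow> seminorm (vsub (g m) (g n)) < e/2"
      using cauchyD[OF g, of "e/2"] e by auto
    have "seminorm (vsub (vadd V (f m) (g m)) (vadd V (f n) (g n))) < e"
      if "m \<ge> max M N" "n \<ge> max M N" for m n
      using M[of m n] N[of m n] that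
        seminorm_triangle[of "vsub (f m) (f n)" "vsub (g m) (g n)"]
      by (simp add: add_sub_add c closed_simps)
    then show ?thesis by blast
  qed
  then show "vadd cauchy f g \<in> vcarrier cauchy"
    by (auto simp: mem_cauchy_iff cauchy_simps c closed_simps)
next
  fix f c assume f: "f \<in> vcarrier cauchy"
  note cf = cauchy_mem[OF f]
  have "\<exists>N. \<forall>m\<ge>N. \<forall>n\<ge>N. seminorm (vsub (vscale V c (f m)) (vscale V c (f n))) < e"
    if e: "e > 0" for e
  proof -
    \<comment> \<open>The summand 1 avoids a division by zero when c = 0.\<close>
    have e': "e / (cmod c + 1) > 0" using e by (simp add: add_nonneg_pos)
    obtain M where M: "\<And>m n. m \<ge> M \<Longrightarrow> n \<ge> M \<Longrightarrow> seminorm (vsub (f m) (f n)) < e / (cmod c + 1)"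
      using cauchyD[OF f e'] by auto
    have "seminorm (vsub (vscale V c (f m)) (vscale V c (f n))) < e"
      if "m \<ge> M" "n \<ge> M" for m n
    proof -
      have "cmod c * seminorm (vsub (f m) (f n)) \<le> (cmod c + 1) * seminorm (vsub (f m) (f n))"
        using cf by (intro mult_right_mono seminorm_nonneg closed_simps) auto
      also have "\<dots> < (cmod c + 1) * (e / (cmod c + 1))"
        using M[OF that] by (intro mult_strict_left_mono) (auto simp: add_nonneg_pos)
      also have "\<dots> = e" using norm_ge_zero[of c] by (simp add: add_nonneg_eq_0_iff)
      finally show ?thesis using cf by (simp add: scale_sub seminorm_scale closed_simps)
    qed
    then show ?thesis by blast
  qed
  then show "vscale cauchy c f \<in> vcarrier cauchy"
    by (auto simp: mem_cauchy_iff cauchy_simps cf closed_simps)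
next
  show "vzero cauchy \<in> vcarrier cauchy"
    using cauchy_const[OF zero_closed] by (simp add: cauchy_simps)
qed (auto simp: cauchy_simps fun_eq_iff cauchy_mem add_assoc add_zero add_inverse
    scale_add_right scale_add_left scale_scale scale_one intro: add_commute)

lemma seminorm_convergent:
  assumes f: "f \<in> vcarrier cauchy"
  shows "convergent (\<lambda>n. seminorm (f n))"
proof -
  have "Cauchy (\<lambda>n. seminorm (f n))"
  proof (rule CauchyI)
    fix e :: real assume "e > 0"
    then obtain N where "\<And>m n. m \<ge> N \<Longrightarrow> n \<ge> N \<Longrightarrow> seminorm (vsub (f m) (f n)) < e"
      using cauchyD[OF f] by metis
    then have "norm (seminorm (f m) - seminorm (f n)) < e" if "m \<ge> N" "n \<ge> N" for m n
      unfolding real_norm_def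
      using that le_less_trans[OF seminorm_diff_le[OF cauchy_mem[OF f] cauchy_mem[OF f]]] by blast
    then show "\<exists>M. \<forall>m\<ge>M. \<forall>n\<ge>M. norm (seminorm (f m) - seminorm (f n)) < e" by blast
  qed
  then show ?thesis by (simp add: Cauchy_convergent_iff)
qed

abbreviation cform :: "(nat \<Rightarrow> 'v) \<Rightarrow> (nat \<Rightarrow> 'v) \<Rightarrow> complex" where
  "cform \<equiv> \<lambda>f g. lim (\<lambda>n. vip V (f n) (g n))"

text \<open>Polarization: the real part is a combination of the squared norms of f n, g n and their
  sum, each of which converges. Replacing g by -i g turns the real part into the imaginary
  part.\<close>

lemma ip_tendsto:
  assumes f: "f \<in> vcarrier cauchy" and g: "g \<in> vcarrier cauchy"
  shows "(\<lambda>n. vip V (f n) (g n)) \<longlonglongrightarrow> cform f g"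
proof -
  interpret C: complex_space cauchy by (rule cauchy_complex_space)
  have Re_conv: "convergent (\<lambda>n. Re (vip V (f n) (g n)))"
    if f: "f \<in> vcarrier cauchy" and g: "g \<in> vcarrier cauchy" for f g
  proof -
    have "Re (vip V (f n) (g n)) =
       ((seminorm (vadd cauchy f g n))\<^sup>2 - (seminorm (f n))\<^sup>2 - (seminorm (g n))\<^sup>2) / 2" for n
      using seminorm_add_sq[OF cauchy_mem[OF f] cauchy_mem[OF g], of n n]
      by (simp add: cauchy_simps)
    moreover obtain a where "(\<lambda>n. seminorm (f n)) \<longlonglongrightarrow> a"
      using seminorm_convergent[OF f] by (auto simp: convergent_def)
    moreover obtain b where "(\<lambda>n. seminorm (g n)) \<longlonglongrightarrow> b"
      using seminorm_convergent[OF g] by (auto simp: convergent_def)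
    moreover obtain c where "(\<lambda>n. seminorm (vadd cauchy f g n)) \<longlonglongrightarrow> c"
      using seminorm_convergent[OF C.add_closed[OF f g]] by (auto simp: convergent_def)
    ultimately have "(\<lambda>n. Re (vip V (f n) (g n))) \<longlonglongrightarrow> (c\<^sup>2 - a\<^sup>2 - b\<^sup>2) / 2"
      by (simp only:) (intro tendsto_intros; simp)
    then show ?thesis by (rule convergentI)
  qed
  have "Re (vip V (f n) (vscale cauchy (- \<i>) g n)) = Im (vip V (f n) (g n))" for n
    using cauchy_mem[OF f] cauchy_mem[OF g] ip_scale[of "f n" "g n" "-\<i>"] by (simp add: cauchy_simps)
  then have "convergent (\<lambda>n. Im (vip V (f n) (g n)))"
    using Re_conv[OF f C.scale_closed[OF g, of "-\<i>"]] by simp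
  with Re_conv[OF f g] obtain a b where
    "(\<lambda>n. Re (vip V (f n) (g n))) \<longlonglongrightarrow> a" "(\<lambda>n. Im (vip V (f n) (g n))) \<longlonglongrightarrow> b"
    by (auto simp: convergent_def)
  then have "(\<lambda>n. vip V (f n) (g n)) \<longlonglongrightarrow> Complex a b"
    using tendsto_Complex by fastforce
  then show ?thesis by (simp add: convergentI convergent_LIMSEQ_iff[symmetric])
qed

sublocale C: semi_inner_space cauchy cform
proof -
  interpret C: complex_space cauchy by (rule cauchy_complex_space)
  show "semi_inner_space cauchy cform"
  proof
    fix f g h c assume f: "f \<in> vcarrier cauchy" and g: "g \<in> vcarrier cauchy"
    note c = cauchy_mem[OF f] cauchy_mem[OF g]
    have "(\<lambda>n. vip V (g n) (f n)) \<longlonglongrightarrow> cnj (cform f g)"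
      using tendsto_cnj[OF ip_tendsto[OF f g]] c by (simp add: ip_cnj[symmetric])
    then show "cform g f = cnj (cform f g)" by (rule limI)
    have "(\<lambda>n. vip V (f n) (vscale cauchy c g n)) \<longlonglongrightarrow> c * cform f g"
      using tendsto_mult_left[OF ip_tendsto[OF f g]] c by (simp add: ip_scale cauchy_simps)
    then show "cform f (vscale cauchy c g) = c * cform f g" by (rule limI)
    assume h: "h \<in> vcarrier cauchy"
    have "(\<lambda>n. vip V (f n) (vadd cauchy g h n)) \<longlonglongrightarrow> cform f g + cform f h"
      using tendsto_add[OF ip_tendsto[OF f g] ip_tendsto[OF f h]] c cauchy_mem[OF h]
      by (simp add: ip_add cauchy_simps)
    then show "cform f (vadd cauchy g h) = cform f g + cform f h" by (rule limI)
  next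
    fix f assume f: "f \<in> vcarrier cauchy"
    show "cform f f \<in> \<real>\<^sub>\<ge>\<^sub>0"
      using Lim_in_closed_set[OF closed_nonneg_Reals_complex _ _ ip_tendsto[OF f f]]
        ip_nonneg[OF cauchy_mem[OF f]] by simp
  qed
qed

lemma seminorm_tendsto:
  assumes f: "f \<in> vcarrier cauchy"
  shows "(\<lambda>n. seminorm (f n)) \<longlonglongrightarrow> C.seminorm f"
  unfolding seminorm_def C.seminorm_def
  by (intro tendsto_intros ip_tendsto f)

text \<open>Exhibits the completion as a quotient by the null vectors of the limit form, so its
  inner product and pre-Hilbert axioms come from the general construction.\<close>

lemma null_seqs_eq: "null_seqs V = C.null"
proof -
  have "(\<lambda>n. ip_dist V (f n) (vzero V)) \<longlonglongrightarrow> 0 \<longleftrightarrow> f \<in> C.null" if f: "f \<in> vcarrier cauchy" for f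
  proof -
    have "ip_dist V (f n) (vzero V) = seminorm (f n)" for n
      using cauchy_mem[OF f] by (simp add: dist_eq closed_simps scale_zero_right add_zero)
    then show ?thesis
      using C.seminorm_eq_0_iff[OF f] seminorm_tendsto[OF f] LIMSEQ_unique by auto
  qed
  then show ?thesis by (auto simp: null_seqs_def C.null_def)
qed

lemma ip_completion_eq: "ip_completion V = C.hquot"
  by (simp add: ip_completion_def null_seqs_eq)

text \<open>
  The limit is a diagonal sequence that picks from \<open>F k\<close> a term within \<open>1 / (k + 1)\<close> of the tail.
\<close>

lemma cauchy_complete:
  assumes F: "\<And>k. F k \<in> vcarrier cauchy"
    and cF: "\<And>e. e > 0 \<Longrightarrow> \<exists>N. \<forall>k\<ge>N. \<forall>l\<ge>N. C.seminorm (C.vsub (F k) (F l)) < e"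
  shows "\<exists>g\<in>vcarrier cauchy. (\<lambda>k. C.seminorm (C.vsub (F k) g)) \<longlonglongrightarrow> 0"
proof -
  have "\<exists>N. \<forall>m\<ge>N. \<forall>n\<ge>N. seminorm (vsub (F k m) (F k n)) < inverse (real (Suc k))" for k
    using F[of k] unfolding mem_cauchy_iff by simp
  then obtain N where N: "\<And>k m n. m \<ge> N k \<Longrightarrow> n \<ge> N k \<Longrightarrow>
      seminorm (vsub (F k m) (F k n)) < inverse (real (Suc k))" by metis
  define g where "g = (\<lambda>k. F k (N k))"
  have g: "g k \<in> vcarrier V" for k using cauchy_mem[OF F] by (simp add: g_def)
  note gc = cauchy_const[OF g]
  have tend: "(\<lambda>n. seminorm (vsub (f n) (h n))) \<longlonglongrightarrow> C.seminorm (C.vsub f h)"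
    if "f \<in> vcarrier cauchy" "h \<in> vcarrier cauchy" for f h
    using seminorm_tendsto[of "C.vsub f h"] that C.closed_simps by (simp add: cauchy_simps)
  have Fg: "C.seminorm (C.vsub (F k) (\<lambda>n. g k)) \<le> inverse (real (Suc k))" for k
  proof (rule LIMSEQ_le_const2[OF tend[OF F gc]])
    show "\<exists>M. \<forall>n\<ge>M. seminorm (vsub (F k n) (g k)) \<le> inverse (real (Suc k))"
      using N[OF _ order_refl] unfolding g_def by (meson less_imp_le)
  qed
  \<comment> \<open>Constant sequences embed V isometrically, so distances between terms of g can be
    estimated among Cauchy sequences.\<close>
  have gg: "C.seminorm (C.vsub (\<lambda>n. g k) (\<lambda>n. g l)) = seminorm (vsub (g k) (g l))" for k l
    using tend[OF gc gc, of k l] by (simp add: LIMSEQ_const_iff)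
  have small: "\<exists>M. \<forall>k\<ge>M. inverse (real (Suc k)) < e" if "e > 0" for e :: real
  proof -
    obtain M where M: "inverse (real (Suc M)) < e" using reals_Archimedean[OF \<open>e > 0\<close>] by blast
    have "inverse (real (Suc k)) < e" if "k \<ge> M" for k
      by (rule le_less_trans[OF le_imp_inverse_le M]) (use that in simp_all)
    then show ?thesis by blast
  qed
  have gcauchy: "g \<in> vcarrier cauchy"
    unfolding mem_cauchy_iff
  proof (intro conjI allI impI g)
    fix e :: real assume "e > 0"
    \<comment> \<open>One third for each leg of the path from g k to F k, on to F l, and then to g
      l.\<close>
    then have "e/3 > 0" by simp
    obtain M1 where M1: "\<And>k l. k \<ge> M1 \<Longrightarrow> l \<ge> M1 \<Longrightarrow> C.seminorm (C.vsub (F k) (F l)) < e/3"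
      using cF[OF \<open>e/3 > 0\<close>] by metis
    obtain M2 where M2: "\<And>k. k \<ge> M2 \<Longrightarrow> inverse (real (Suc k)) < e/3"
      using small[OF \<open>e/3 > 0\<close>] by metis
    have "seminorm (vsub (g k) (g l)) < e" if k: "k \<ge> max M1 M2" and l: "l \<ge> max M1 M2" for k l
    proof -
      have "C.seminorm (C.vsub (\<lambda>n. g k) (F k)) < e/3"
        using C.seminorm_sub_commute[OF gc F, of k k] Fg[of k] M2[of k] k by simp
      moreover have "C.seminorm (C.vsub (F l) (\<lambda>n. g l)) < e/3"
        using Fg[of l] M2[of l] l by simp
      moreover have "C.seminorm (C.vsub (F k) (F l)) < e/3" using M1 k l by simp
      ultimately show ?thesis
        using C.seminorm_sub_triangle[OF gc F gc, of k l k] C.seminorm_sub_triangle[OF F F gc, of k l l]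
        unfolding gg by linarith
    qed
    then show "\<exists>N. \<forall>m\<ge>N. \<forall>n\<ge>N. seminorm (vsub (g m) (g n)) < e" by blast
  qed
  have "(\<lambda>k. C.seminorm (C.vsub (F k) g)) \<longlonglongrightarrow> 0"
  proof (rule LIMSEQ_I)
    fix e :: real assume "e > 0"
    \<comment> \<open>The limit over n preserves only the weak bound e/4 on the distance from the
      constant sequence g k to g; together with e/2 it still stays strictly below e.\<close>
    then have "e/2 > 0" and "e/4 > 0" by simp_all
    obtain M1 where M1: "\<And>k l. k \<ge> M1 \<Longrightarrow> l \<ge> M1 \<Longrightarrow> seminorm (vsub (g k) (g l)) < e/4"
      using cauchyD[OF gcauchy \<open>e/4 > 0\<close>] by metis
    obtain M2 where M2: "\<And>k. k \<ge> M2 \<Longrightarrow> inverse (real (Suc k)) < e/2"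
      using small[OF \<open>e/2 > 0\<close>] by metis
    have "norm (C.seminorm (C.vsub (F k) g) - 0) < e" if k: "k \<ge> max M1 M2" for k
    proof -
      have "C.seminorm (C.vsub (\<lambda>n. g k) g) \<le> e/4"
      proof (rule LIMSEQ_le_const2[OF tend[OF gc gcauchy]])
        show "\<exists>M. \<forall>n\<ge>M. seminorm (vsub (g k) (g n)) \<le> e/4"
          using M1 k by (meson less_imp_le max.boundedE)
      qed
      moreover have "C.seminorm (C.vsub (F k) (\<lambda>n. g k)) < e/2"
        using Fg[of k] M2[of k] k by simp
      moreover have "0 \<le> C.seminorm (C.vsub (F k) g)"
        by (intro C.seminorm_nonneg C.closed_simps F gcauchy)
      ultimately show ?thesis
        using C.seminorm_sub_triangle[OF F gc gcauchy, of k k] \<open>e > 0\<close> by simp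
    qed
    then show "\<exists>M. \<forall>k\<ge>M. norm (C.seminorm (C.vsub (F k) g) - 0) < e" by blast
  qed
  then show ?thesis using gcauchy by blast
qed

lemma ip_completion_hilbert: "hilbert_space (ip_completion V)"
proof -
  interpret H: pre_hilbert_space C.hquot by (rule C.hquot_pre_hilbert)
  have "\<exists>x. limitin H.metric.mtopology X x sequentially" if X: "H.metric.MCauchy X" for X
  proof -
    have "range X \<subseteq> vcarrier C.hquot" using X by (simp add: H.metric.MCauchy_def)
    then have "\<forall>k. \<exists>f. f \<in> vcarrier cauchy \<and> X k = C.cls f"
      unfolding C.hquot_carrier by blast
    then obtain F where F: "\<And>k. F k \<in> vcarrier cauchy" "\<And>k. X k = C.cls (F k)" by metis
    have cF: "\<exists>N. \<forall>k\<ge>N. \<forall>l\<ge>N. C.seminorm (C.vsub (F k) (F l)) < e" if "e > 0" for e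
    proof -
      have "\<exists>N. \<forall>n n'. N \<le> n \<longrightarrow> N \<le> n' \<longrightarrow> ip_dist C.hquot (X n) (X n') < e"
        using X that by (simp add: H.metric.MCauchy_def)
      then show ?thesis by (simp add: F C.hquot_dist)
    qed
    obtain g where g: "g \<in> vcarrier cauchy" "(\<lambda>k. C.seminorm (C.vsub (F k) g)) \<longlonglongrightarrow> 0"
      using cauchy_complete[OF F(1) cF] by auto
    have "limitin H.metric.mtopology X (C.cls g) sequentially"
      unfolding H.metric.limitin_metric_dist_null
      using g by (simp add: F C.hquot_dist C.hquot_carrier)
    then show ?thesis by blast
  qed
  then have "H.metric.mcomplete" by (simp add: H.metric.mcomplete_def)
  then show ?thesis unfolding ip_completion_eq by unfold_locales
qed

end

section \<open>Unitary maps\<close>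

text \<open>Linearity is automatic: \<open>\<parallel>U (x + y) - U x - U y\<parallel>\<close> expands into inner products.\<close>

lemma unitary_map_if_ip_preserving:
  assumes H: "pre_hilbert_space H" and K: "pre_hilbert_space K"
    and UH: "U ` vcarrier H = vcarrier K"
    and ip: "\<And>x y. x \<in> vcarrier H \<Longrightarrow> y \<in> vcarrier H \<Longrightarrow> vip K (U x) (U y) = vip H x y"
  shows "unitary_map H K U"
proof -
  interpret H: pre_hilbert_space H by (rule H)
  interpret K: pre_hilbert_space K by (rule K)
  have U: "U x \<in> vcarrier K" if "x \<in> vcarrier H" for x using UH that by blast
  have eqI: "a = b" if "a \<in> vcarrier K" "b \<in> vcarrier K"
    "vip K a a = vip K a b" "vip K b a = vip K b b" for a b
  proof -
    have "vip K (K.vsub a b) (K.vsub a b) = 0" using that by (simp add: K.form_simps)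
    then have "K.vsub a b = vzero K" using that by (intro K.ip_definite K.closed_simps)
    then show ?thesis using K.sub_eq_zero_iff that by simp
  qed
  have "inj_on U (vcarrier H)"
  proof (rule inj_onI)
    fix x y assume xy: "x \<in> vcarrier H" "y \<in> vcarrier H" "U x = U y"
    then have "vip H (H.vsub x y) (H.vsub x y) = 0"
      using ip[of x x] ip[of x y] ip[of y x] ip[of y y] by (simp add: H.form_simps)
    then have "H.vsub x y = vzero H" using xy by (intro H.ip_definite H.closed_simps)
    then show "x = y" using H.sub_eq_zero_iff xy by simp
  qed
  then have "bij_betw U (vcarrier H) (vcarrier K)" using UH by (simp add: bij_betw_def)
  moreover have "U (vadd H x y) = vadd K (U x) (U y)" if "x \<in> vcarrier H" "y \<in> vcarrier H" for x y
    using that by (intro eqI) (simp_all add: U ip H.form_simps K.form_simps)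
  moreover have "U (vscale H c x) = vscale K c (U x)" if "x \<in> vcarrier H" for x c
    using that by (intro eqI) (simp_all add: U ip H.form_simps K.form_simps)
  ultimately show ?thesis by (simp add: unitary_map_def ip)
qed

text \<open>The map T may be any function: preservation of the form alone forces it to respect
  classes and to induce a linear map. It is applied to a choice of representatives out of
  \<open>R\<close> and to termwise application of a unitary on Cauchy sequences.\<close>

lemma quotient_unitary_map:
  assumes "semi_inner_space V s" "semi_inner_space V' s'"
    and T: "\<And>x. x \<in> vcarrier V \<Longrightarrow> T x \<in> vcarrier V'"
    and form: "\<And>x y. x \<in> vcarrier V \<Longrightarrow> y \<in> vcarrier V \<Longrightarrow> s' (T x) (T y) = s x y"
    and surj: "\<And>y. y \<in> vcarrier V' \<Longrightarrow> \<exists>x\<in>vcarrier V.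
       vadd V' (T x) (vscale V' (-1) y) \<in> semi_inner_space.null V' s'"
  shows "\<exists>U. unitary_map (quotient_ip_space V (semi_inner_space.null V s) s)
    (quotient_ip_space V' (semi_inner_space.null V' s') s') U"
proof -
  interpret A: semi_inner_space V s by (rule assms)
  interpret B: semi_inner_space V' s' by (rule assms)
  define rep where "rep X = (SOME x. x \<in> vcarrier V \<and> A.cls x = X)" for X
  have rep: "rep X \<in> vcarrier V" "A.cls (rep X) = X" if "X \<in> vcarrier A.hquot" for X
  proof -
    have "\<exists>x. x \<in> vcarrier V \<and> A.cls x = X" using that by (auto simp: A.hquot_carrier)
    then have "rep X \<in> vcarrier V \<and> A.cls (rep X) = X" unfolding rep_def by (rule someI_ex)
    then show "rep X \<in> vcarrier V" "A.cls (rep X) = X" by auto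
  qed
  define U where "U X = B.cls (T (rep X))" for X
  have ip: "vip B.hquot (U X) (U Y) = vip A.hquot X Y"
    if "X \<in> vcarrier A.hquot" "Y \<in> vcarrier A.hquot" for X Y
    using rep[OF that(1)] rep[OF that(2)] A.hquot_ip[of "rep X" "rep Y"]
    by (simp add: U_def B.hquot_ip T form)
  have cls: "U (A.cls x) = B.cls (T x)" if x: "x \<in> vcarrier V" for x
  proof -
    let ?r = "rep (A.cls x)"
    have r: "?r \<in> vcarrier V" "A.cls ?r = A.cls x" using rep x by (auto simp: A.hquot_carrier)
    have "s (A.vsub ?r x) (A.vsub ?r x) = 0"
      using r A.cls_eq_iff x by (auto simp: A.null_def)
    \<comment> \<open>No additivity of T enters: both self-products expand into the four pairings of
      the two vectors, and T preserves each of these.\<close>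
    then have "s' (B.vsub (T ?r) (T x)) (B.vsub (T ?r) (T x)) = 0"
      using r x by (simp add: A.form_simps B.form_simps T form)
    then have "B.vsub (T ?r) (T x) \<in> B.null" using r x T by (simp add: B.null_def B.closed_simps)
    then show ?thesis using B.cls_eq_iff T r x by (simp add: U_def)
  qed
  have "U ` vcarrier A.hquot = vcarrier B.hquot"
  proof
    show "U ` vcarrier A.hquot \<subseteq> vcarrier B.hquot"
      using rep T by (auto simp: U_def B.hquot_carrier)
    show "vcarrier B.hquot \<subseteq> U ` vcarrier A.hquot"
    proof
      fix Y assume "Y \<in> vcarrier B.hquot"
      then obtain y where y: "y \<in> vcarrier V'" "Y = B.cls y" by (auto simp: B.hquot_carrier)
      then obtain x where x: "x \<in> vcarrier V" "B.vsub (T x) y \<in> B.null" using surj by blast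
      then have "U (A.cls x) = Y" using B.cls_eq_iff T y cls by simp
      then show "Y \<in> U ` vcarrier A.hquot" using x by (auto simp: A.hquot_carrier)
    qed
  qed
  then have "unitary_map A.hquot B.hquot U"
    using unitary_map_if_ip_preserving A.hquot_pre_hilbert B.hquot_pre_hilbert ip by blast
  then show ?thesis by blast
qed

text \<open>The unitary is applied termwise. It preserves distances, hence the Cauchy property, and
  it carries the limit form over because the sequences of inner products agree term by term.\<close>

lemma completion_unitarily_equivalent:
  assumes H: "pre_hilbert_space H" and K: "pre_hilbert_space K" and U: "unitary_map H K U"
  shows "unitarily_equivalent (ip_completion H) (ip_completion K)"
proof -
  interpret H: pre_hilbert_space H by (rule H)
  interpret K: pre_hilbert_space K by (rule K)
  have bij: "bij_betw U (vcarrier H) (vcarrier K)"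
    and add: "\<And>x y. x \<in> vcarrier H \<Longrightarrow> y \<in> vcarrier H \<Longrightarrow> U (vadd H x y) = vadd K (U x) (U y)"
    and scale: "\<And>c x. x \<in> vcarrier H \<Longrightarrow> U (vscale H c x) = vscale K c (U x)"
    and ip: "\<And>x y. x \<in> vcarrier H \<Longrightarrow> y \<in> vcarrier H \<Longrightarrow> vip K (U x) (U y) = vip H x y"
    using U by (auto simp: unitary_map_def)
  have UK: "U x \<in> vcarrier K" if "x \<in> vcarrier H" for x using bij that by (auto simp: bij_betw_def)
  have nrm: "K.seminorm (K.vsub (U x) (U y)) = H.seminorm (H.vsub x y)"
    if "x \<in> vcarrier H" "y \<in> vcarrier H" for x y
    using that by (simp add: add[symmetric] scale[symmetric] H.closed_simps
        K.seminorm_def H.seminorm_def ip)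
  have cau: "(\<lambda>n. U (f n)) \<in> vcarrier K.cauchy \<longleftrightarrow> f \<in> vcarrier H.cauchy"
    if "\<And>n. f n \<in> vcarrier H" for f :: "nat \<Rightarrow> _"
    using that by (simp add: H.mem_cauchy_iff K.mem_cauchy_iff UK nrm)
  have "\<exists>U'. unitary_map H.C.hquot K.C.hquot U'"
  proof (rule quotient_unitary_map[OF H.C.semi_inner_space_axioms K.C.semi_inner_space_axioms])
    fix f assume f: "f \<in> vcarrier H.cauchy"
    then show "(\<lambda>n. U (f n)) \<in> vcarrier K.cauchy" using cau H.cauchy_mem by blast
    fix g assume g: "g \<in> vcarrier H.cauchy"
    show "K.cform (\<lambda>n. U (f n)) (\<lambda>n. U (g n)) = H.cform f g"
      using H.cauchy_mem[OF f] H.cauchy_mem[OF g] by (simp add: ip)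
  next
    fix g assume g: "g \<in> vcarrier K.cauchy"
    \<comment> \<open>The termwise preimage is Cauchy by the converse direction of
      \<open>cau\<close>, and its image is g exactly, so the required difference is the zero
      sequence.\<close>
    let ?f = "\<lambda>n. inv_into (vcarrier H) U (g n)"
    have Uf: "U (?f n) = g n" and f: "?f n \<in> vcarrier H" for n
      using bij K.cauchy_mem[OF g, of n] by (auto simp: bij_betw_def f_inv_into_f inv_into_into)
    have "?f \<in> vcarrier H.cauchy" using cau[of ?f] f g by (simp add: Uf)
    moreover have "K.C.vsub (\<lambda>n. U (?f n)) g \<in> K.C.null"
      using g K.C.null.sub_zero by (simp add: Uf K.C.add_inverse)
    ultimately show "\<exists>f\<in>vcarrier H.cauchy. K.C.vsub (\<lambda>n. U (f n)) g \<in> K.C.null"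
      by (intro bexI[of _ ?f])
  qed
  then show ?thesis
    using H.ip_completion_hilbert K.ip_completion_hilbert
    by (simp add: unitarily_equivalent_def H.ip_completion_eq K.ip_completion_eq)
qed

section \<open>The reduced algebra\<close>

lemma scaleC_one: "1 *\<^sub>C x = (x :: 'a::unital_cstar_algebra)"
  using scaleR_scaleC[of 1 x] by simp

lemma scaleC_zero_left: "0 *\<^sub>C x = (0 :: 'a::unital_cstar_algebra)"
  using scaleR_scaleC[of 0 x] by simp

lemma scaleC_zero_right: "c *\<^sub>C 0 = (0 :: 'a::unital_cstar_algebra)"
  using scaleC_scaleC[of c 0 "0::'a"] by (simp add: scaleC_zero_left)

lemma scaleC_minus_left: "(- c) *\<^sub>C x = - (c *\<^sub>C (x :: 'a::unital_cstar_algebra))"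
  using scaleC_add_left[of "-c" c x] by (simp add: scaleC_zero_left eq_neg_iff_add_eq_0)

lemma scaleC_minus_right: "c *\<^sub>C (- x) = - (c *\<^sub>C (x :: 'a::unital_cstar_algebra))"
  using scaleC_add_right[of c "-x" x] by (simp add: scaleC_zero_right eq_neg_iff_add_eq_0)

lemma scaleC_diff_right: "c *\<^sub>C (x - y) = c *\<^sub>C x - c *\<^sub>C (y :: 'a::unital_cstar_algebra)"
  using scaleC_add_right[of c x "-y"] by (simp add: scaleC_minus_right)

lemma scaleC_scaleR: "c *\<^sub>C r *\<^sub>R x = r *\<^sub>R c *\<^sub>C (x :: 'a::unital_cstar_algebra)"
  by (simp add: scaleR_scaleC scaleC_scaleC mult.commute)

lemma scaleC_Re_Im:
  "c *\<^sub>C x = Re c *\<^sub>R x + \<i> *\<^sub>C Im c *\<^sub>R (x :: 'a::unital_cstar_algebra)"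
  unfolding scaleR_scaleC scaleC_scaleC scaleC_add_left[symmetric]
  by (simp only: complex_eq[symmetric])

lemma adj_zero: "adj 0 = (0 :: 'a::unital_cstar_algebra)"
  using adj_scaleC[of 0 "0::'a"] by (simp add: scaleC_zero_left)

lemma adj_minus: "adj (- x) = - adj (x :: 'a::unital_cstar_algebra)"
  using adj_add[of x "-x"] by (simp add: adj_zero eq_neg_iff_add_eq_0 add.commute)

lemma adj_diff: "adj (x - y) = adj x - adj (y :: 'a::unital_cstar_algebra)"
  using adj_add[of x "-y"] by (simp add: adj_minus)

lemma adj_scaleR: "adj (r *\<^sub>R x) = r *\<^sub>R adj (x :: 'a::unital_cstar_algebra)"
  by (simp add: scaleR_scaleC adj_scaleC)

lemma subspace_selfadjoint: "subspace (selfadjoint :: 'a::unital_cstar_algebra set)"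
  by (auto simp: subspace_def selfadjoint_def adj_zero adj_add adj_scaleR)

lemma selfadjoint_jordan_prod:
  "a \<in> selfadjoint \<Longrightarrow> b \<in> selfadjoint \<Longrightarrow> jordan_prod a b \<in> selfadjoint"
  by (simp add: selfadjoint_def jordan_prod_def adj_scaleR adj_add adj_mult add.commute)

lemma selfadjoint_lie_bracket:
  "a \<in> selfadjoint \<Longrightarrow> b \<in> selfadjoint \<Longrightarrow> lie_bracket lam a b \<in> selfadjoint"
  by (simp add: selfadjoint_def lie_bracket_def adj_scaleC adj_diff adj_mult
      scaleC_minus_left scaleC_diff_right)

lemma jordan_prod_commute: "jordan_prod a b = jordan_prod b a"
  by (simp add: jordan_prod_def add.commute)

lemma lie_bracket_swap: "lie_bracket lam b a = - lie_bracket lam a b"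
  by (simp add: lie_bracket_def scaleC_diff_right)

lemma lie_bracket_zero: "lie_bracket lam 0 j = 0"
  and lie_bracket_add: "lie_bracket lam (a + b) j = lie_bracket lam a j + lie_bracket lam b j"
  and lie_bracket_scaleR: "lie_bracket lam (r *\<^sub>R a) j = r *\<^sub>R lie_bracket lam a j"
  by (simp_all add: lie_bracket_def scaleC_zero_right scaleC_diff_right scaleC_add_right
      scaleC_scaleR algebra_simps)

text \<open>Leibniz rule: a commutator with j is a derivation of the associative product and hence
  of its symmetrization.\<close>

lemma lie_bracket_jordan_prod:
  "lie_bracket lam (jordan_prod a b) j
    = jordan_prod a (lie_bracket lam b j) + jordan_prod (lie_bracket lam a j) b"
  by (simp add: lie_bracket_def jordan_prod_def scaleC_diff_right scaleC_add_right scaleC_scaleR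
      mult_scaleC_left mult_scaleC_right algebra_simps)

text \<open>Jacobi identity, written so that the action of [a, b] on j is the commutator of the
  actions of a and b. If both actions preserve J, so does that of [a, b].\<close>

lemma lie_bracket_jacobi:
  "lie_bracket lam (lie_bracket lam a b) j
    = lie_bracket lam a (lie_bracket lam b j) - lie_bracket lam b (lie_bracket lam a j)"
  by (simp add: lie_bracket_def scaleC_diff_right scaleC_add_right mult_scaleC_left
      mult_scaleC_right scaleC_scaleC algebra_simps)

lemma mult_eq_jordan_lie:
  assumes "lam \<noteq> 0"
  shows "a * b = jordan_prod a b + \<i> *\<^sub>C (- 1 / (2 * lam)) *\<^sub>R lie_bracket lam a b"
proof -
  \<comment> \<open>Half the commutator is [a, b] / (2 i lam). Writing 1 / (2 i lam) as i times the
    real number -1 / (2 lam) displays the product as a real part plus i times another, as membership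
    in a complexification requires.\<close>
  have "\<i> * (complex_of_real (- 1 / (2 * lam)) * (\<i> * complex_of_real lam)) = complex_of_real (1/2)"
    using assms by (simp add: field_simps)
  then have "\<i> *\<^sub>C (- 1 / (2 * lam)) *\<^sub>R lie_bracket lam a b = (1/2) *\<^sub>R (a * b - b * a)"
    by (simp only: lie_bracket_def scaleR_scaleC scaleC_scaleC)
  then have "jordan_prod a b + \<i> *\<^sub>C (- 1 / (2 * lam)) *\<^sub>R lie_bracket lam a b
      = (1/2) *\<^sub>R (a * b + a * b)"
    by (simp add: jordan_prod_def scaleR_add_right[symmetric] del: scaleR_add_right)
  then show ?thesis by (simp add: scaleR_2[symmetric])
qed

section \<open>Complexifications of real subspaces\<close>

lemma complexificationI: "a \<in> X \<Longrightarrow> b \<in> X \<Longrightarrow> a + \<i> *\<^sub>C b \<in> complexification X"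
  by (auto simp: complexification_def)

lemma complexificationE:
  assumes "x \<in> complexification X"
  obtains a b where "a \<in> X" "b \<in> X" "x = a + \<i> *\<^sub>C b"
  using assms that unfolding complexification_def by blast

lemma complexification_incl: "subspace X \<Longrightarrow> a \<in> X \<Longrightarrow> a \<in> complexification X"
  using complexificationI[of a X 0] by (simp add: subspace_0 scaleC_zero_right)

lemma complexification_zero: "subspace X \<Longrightarrow> 0 \<in> complexification X"
  by (intro complexification_incl subspace_0)

lemma complexification_add:
  assumes X: "subspace X" and x: "x \<in> complexification X" and y: "y \<in> complexification X"
  shows "x + y \<in> complexification X"
proof -
  obtain a b where 1: "a \<in> X" "b \<in> X" "x = a + \<i> *\<^sub>C b" using x by (rule complexificationE)
  obtain c d where 2: "c \<in> X" "d \<in> X" "y = c + \<i> *\<^sub>C d" using y by (rule complexificationE)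
  have "x + y = (a + c) + \<i> *\<^sub>C (b + d)" by (simp add: 1 2 scaleC_add_right)
  then show ?thesis using complexificationI subspace_add[OF X] 1 2 by metis
qed

lemma complexification_scaleC:
  assumes X: "subspace X" and x: "x \<in> complexification X"
  shows "c *\<^sub>C x \<in> complexification X"
proof -
  obtain a b where 1: "a \<in> X" "b \<in> X" "x = a + \<i> *\<^sub>C b" using x by (rule complexificationE)
  have "c *\<^sub>C x = (Re c *\<^sub>R a - Im c *\<^sub>R b) + \<i> *\<^sub>C (Im c *\<^sub>R a + Re c *\<^sub>R b)"
    unfolding 1 scaleC_add_right scaleC_scaleC[of c] scaleC_Re_Im[of c a] scaleC_Re_Im[of "c * \<i>" b]
    by (simp add: scaleC_add_right scaleC_minus_right algebra_simps)
  then show ?thesis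
    using complexificationI[of _ X] subspace_add[OF X] subspace_diff[OF X] subspace_scale[OF X] 1
    by metis
qed

lemma complexification_adj:
  assumes X: "subspace X" "X \<subseteq> selfadjoint" and x: "x \<in> complexification X"
  shows "adj x \<in> complexification X"
proof -
  obtain a b where 1: "a \<in> X" "b \<in> X" "x = a + \<i> *\<^sub>C b" using x by (rule complexificationE)
  have "adj a = a" "adj b = b" using 1 X(2) by (auto simp: selfadjoint_def)
  then have "adj x = a + \<i> *\<^sub>C (- b)"
    by (simp add: 1 adj_add adj_scaleC scaleC_minus_left scaleC_minus_right)
  then show ?thesis using complexificationI subspace_neg[OF X(1)] 1 by metis
qed

lemma complexification_mult:
  assumes Z: "subspace Z"
    and XY: "\<And>a b. a \<in> X \<Longrightarrow> b \<in> Y \<Longrightarrow> a * b \<in> complexification Z"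
    and x: "x \<in> complexification X" and y: "y \<in> complexification Y"
  shows "x * y \<in> complexification Z"
proof -
  obtain a b where 1: "a \<in> X" "b \<in> X" "x = a + \<i> *\<^sub>C b" using x by (rule complexificationE)
  obtain c d where 2: "c \<in> Y" "d \<in> Y" "y = c + \<i> *\<^sub>C d" using y by (rule complexificationE)
  have "x * y = (a * c + \<i> *\<^sub>C (a * d)) + \<i> *\<^sub>C (b * c + \<i> *\<^sub>C (b * d))"
    by (simp add: 1 2 mult_scaleC_left mult_scaleC_right scaleC_add_right algebra_simps)
  then show ?thesis
    using 1 2 by (simp add: XY complexification_add[OF Z] complexification_scaleC[OF Z])
qed

text \<open>Self-adjoint real and imaginary parts are unique, as seen by comparing an element with
  its adjoint. This rewrites \<open>reduced_ideal\<close> as the complexification of one real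
  subspace, where products can be checked on self-adjoint elements.\<close>

lemma complexification_Int:
  assumes "X \<subseteq> selfadjoint" "Y \<subseteq> selfadjoint"
  shows "complexification X \<inter> complexification Y = complexification (X \<inter> Y)"
proof
  show "complexification (X \<inter> Y) \<subseteq> complexification X \<inter> complexification Y"
    by (auto simp: complexification_def)
  show "complexification X \<inter> complexification Y \<subseteq> complexification (X \<inter> Y)"
  proof
    fix x assume "x \<in> complexification X \<inter> complexification Y"
    then have X: "x \<in> complexification X" and Y: "x \<in> complexification Y" by auto
    obtain a b where 1: "a \<in> X" "b \<in> X" "x = a + \<i> *\<^sub>C b" using X by (rule complexificationE)
    obtain c d where 2: "c \<in> Y" "d \<in> Y" "x = c + \<i> *\<^sub>C d" using Y by (rule complexificationE)
    have sa: "adj a = a" "adj b = b" "adj c = c" "adj d = d"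
      using 1 2 assms by (auto simp: selfadjoint_def)
    have "adj (a + \<i> *\<^sub>C b) = adj (c + \<i> *\<^sub>C d)" using 1 2 by simp
    then have "a - \<i> *\<^sub>C b = c - \<i> *\<^sub>C d"
      by (simp add: adj_add adj_scaleC scaleC_minus_left sa)
    moreover have e: "a + \<i> *\<^sub>C b = c + \<i> *\<^sub>C d" using 1 2 by simp
    ultimately have "(a - \<i> *\<^sub>C b) + (a + \<i> *\<^sub>C b) = (c - \<i> *\<^sub>C d) + (c + \<i> *\<^sub>C d)"
      by (simp only:)
    then have "2 *\<^sub>R a = 2 *\<^sub>R c" by (simp add: scaleR_2)
    then have "a = c" by simp
    with e have "\<i> *\<^sub>C (\<i> *\<^sub>C b) = \<i> *\<^sub>C (\<i> *\<^sub>C d)" by simp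
    then have "b = d" by (simp add: scaleC_scaleC scaleC_minus_left scaleC_one)
    then show "x \<in> complexification (X \<inter> Y)" using 1 2 \<open>a = c\<close> by (auto intro: complexificationI)
  qed
qed

lemma lin_sub_simps:
  "vcarrier (lin_sub S) = S" "vadd (lin_sub S) = (+)" "vzero (lin_sub S) = 0"
  "vscale (lin_sub S) = scaleC"
  by (simp_all add: lin_sub_def)

lemma cstar_sub_simps:
  "vcarrier (cstar_sub S) = S" "vadd (cstar_sub S) = (+)" "vzero (cstar_sub S) = 0"
  "vscale (cstar_sub S) = scaleC" "amult (cstar_sub S) = (*)" "aone (cstar_sub S) = 1"
  "aadj (cstar_sub S) = adj"
  by (simp_all add: cstar_sub_def lin_sub_def cspace.defs cstar.defs)

lemma lin_sub_complex_space:
  fixes S :: "'a::unital_cstar_algebra set"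
  assumes "0 \<in> S" "\<And>x y. x \<in> S \<Longrightarrow> y \<in> S \<Longrightarrow> x + y \<in> S" "\<And>c x. x \<in> S \<Longrightarrow> c *\<^sub>C x \<in> S"
  shows "complex_space (lin_sub S)"
  using assms
  by unfold_locales (auto simp: lin_sub_simps scaleC_add_left scaleC_add_right scaleC_scaleC
      scaleC_one scaleC_minus_left add_ac)

text \<open>The state lives on the whole algebra, so S is only a linear subspace and products of its
  elements may leave it; this matters for \<open>sumC\<close>.\<close>

lemma state_semi_inner:
  fixes \<omega> :: "'a::unital_cstar_algebra \<Rightarrow> complex"
  assumes S: "complex_space (lin_sub S)" and \<omega>: "state (cstar_sub UNIV) \<omega>"
  shows "semi_inner_space (lin_sub S) (\<lambda>x y. \<omega> (adj x * y))"
proof -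
  have add: "\<omega> (x + y) = \<omega> x + \<omega> y" and scale: "\<omega> (c *\<^sub>C x) = c * \<omega> x"
    and pos: "\<omega> (adj x * x) \<in> \<real>\<^sub>\<ge>\<^sub>0" for x y c
    using \<omega> by (auto simp: state_def cstar_sub_simps)
  have Im: "Im (\<omega> (adj x * x)) = 0" for x using pos[of x] by (simp add: complex_nonneg_Reals_iff)
  \<comment> \<open>Hermitian symmetry is extracted from positivity: reality of the form at x + y
    compares imaginary parts, and at x + i y it compares real parts.\<close>
  have herm: "\<omega> (adj y * x) = cnj (\<omega> (adj x * y))" for x y
  proof -
    have "\<omega> (adj (x + y) * (x + y)) = \<omega> (adj x * x) + \<omega> (adj x * y) + \<omega> (adj y * x) + \<omega> (adj y * y)"
      by (simp add: adj_add ring_distribs add)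
    then have 1: "Im (\<omega> (adj x * y)) + Im (\<omega> (adj y * x)) = 0"
      using Im[of "x + y"] by (simp add: Im)
    have "\<omega> (adj (x + \<i> *\<^sub>C y) * (x + \<i> *\<^sub>C y)) =
        \<omega> (adj x * x) + \<i> * \<omega> (adj x * y) - \<i> * \<omega> (adj y * x) + \<omega> (adj y * y)"
      by (simp add: adj_add adj_scaleC ring_distribs add mult_scaleC_left mult_scaleC_right scale)
    then have 2: "Re (\<omega> (adj x * y)) - Re (\<omega> (adj y * x)) = 0"
      using Im[of "x + \<i> *\<^sub>C y"] by (simp add: Im)
    from 1 2 show ?thesis by (simp add: complex_eq_iff)
  qed
  interpret complex_space "lin_sub S" by (rule S)
  show ?thesis
    by unfold_locales
      (auto simp: lin_sub_simps ring_distribs add mult_scaleC_right scale pos intro: herm)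
qed

section \<open>The normalizer, its ideal and the quotient algebra\<close>

locale jordan_reduction =
  fixes lam :: real and J :: "'a::unital_cstar_algebra set"
  assumes lam: "lam \<noteq> 0" and J: "jordan_ideal J"
begin

abbreviation "N \<equiv> normalizer lam J"
abbreviation "NC \<equiv> normalizerC lam J"
abbreviation "I \<equiv> reduced_ideal lam J"
abbreviation "R \<equiv> reduced_algebra lam J"

lemma J_sa: "J \<subseteq> selfadjoint" and J_subspace: "subspace J"
  and J_jordan: "a \<in> selfadjoint \<Longrightarrow> j \<in> J \<Longrightarrow> jordan_prod a j \<in> J"
  using J by (auto simp: jordan_ideal_def)

lemma J_jordan': "a \<in> selfadjoint \<Longrightarrow> j \<in> J \<Longrightarrow> jordan_prod j a \<in> J"
  using J_jordan jordan_prod_commute by metis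

lemma N_sa: "N \<subseteq> selfadjoint" and N_lie: "a \<in> N \<Longrightarrow> j \<in> J \<Longrightarrow> lie_bracket lam a j \<in> J"
  by (auto simp: normalizer_def)

lemma N_subspace: "subspace N"
  unfolding subspace_def normalizer_def
  by (auto simp: lie_bracket_zero lie_bracket_add lie_bracket_scaleR
      intro!: subspace_0[OF subspace_selfadjoint] subspace_0[OF J_subspace]
        subspace_add[OF subspace_selfadjoint] subspace_add[OF J_subspace]
        subspace_scale[OF subspace_selfadjoint] subspace_scale[OF J_subspace])

text \<open>After the Leibniz rule, each term is a Jordan product of a bracket lying in J with a
  self-adjoint element.\<close>

lemma N_jordan_prod:
  assumes "a \<in> N" "b \<in> N"
  shows "jordan_prod a b \<in> N"
proof -
  have sa: "a \<in> selfadjoint" "b \<in> selfadjoint" using assms N_sa by auto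
  have "lie_bracket lam (jordan_prod a b) j \<in> J" if "j \<in> J" for j
    unfolding lie_bracket_jordan_prod
    by (intro subspace_add[OF J_subspace] J_jordan J_jordan' N_lie sa assms that)
  then show ?thesis using selfadjoint_jordan_prod[OF sa] by (simp add: normalizer_def)
qed

lemma N_lie_bracket: "a \<in> N \<Longrightarrow> b \<in> N \<Longrightarrow> lie_bracket lam a b \<in> N"
  by (auto simp: normalizer_def selfadjoint_lie_bracket lie_bracket_jacobi
      intro!: subspace_diff[OF J_subspace])

lemma jordan_square_in_N:
  assumes j: "j \<in> J"
  shows "jordan_prod j j \<in> N"
proof -
  have sa: "j \<in> selfadjoint" using j J_sa by auto
  have "lie_bracket lam (jordan_prod j j) k \<in> J" if "k \<in> J" for k
  proof -
    \<comment> \<open>The roles are reversed compared with \<open>N_jordan_prod\<close>: here the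
      factor j supplies membership in J, and the bracket is merely the self-adjoint
      multiplier.\<close>
    have "lie_bracket lam j k \<in> selfadjoint" using that J_sa sa selfadjoint_lie_bracket by auto
    then show ?thesis
      unfolding lie_bracket_jordan_prod
      by (intro subspace_add[OF J_subspace] J_jordan J_jordan' j)
  qed
  then show ?thesis using selfadjoint_jordan_prod[OF sa sa] by (simp add: normalizer_def)
qed

lemma I_eq: "I = complexification (N \<inter> J)"
  by (simp add: reduced_ideal_def normalizerC_def complexification_Int N_sa J_sa)

lemma NJ_subspace: "subspace (N \<inter> J)"
  by (intro subspace_inter N_subspace J_subspace)

lemma mult_in_complexification:
  assumes "subspace Z" "jordan_prod a b \<in> Z" "lie_bracket lam a b \<in> Z"
  shows "a * b \<in> complexification Z"
  unfolding mult_eq_jordan_lie[OF lam, of a b]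
  by (intro complexificationI assms subspace_scale)

lemma NC_mult: "x \<in> NC \<Longrightarrow> y \<in> NC \<Longrightarrow> x * y \<in> NC"
  unfolding normalizerC_def
  by (rule complexification_mult[OF N_subspace mult_in_complexification[OF N_subspace]])
    (auto intro: N_jordan_prod N_lie_bracket)

text \<open>One half of the two-sided ideal property, which makes the product of cosets in
  \<open>R\<close> independent of representatives. On self-adjoint elements, N is closed under both
  operations, and J absorbs Jordan products with self-adjoint elements and brackets with N.\<close>

lemma I_mult_left: "x \<in> NC \<Longrightarrow> y \<in> I \<Longrightarrow> x * y \<in> I"
  unfolding normalizerC_def I_eq
  by (rule complexification_mult[OF NJ_subspace mult_in_complexification[OF NJ_subspace]])
    (use N_sa in \<open>auto intro: N_jordan_prod N_lie_bracket N_lie J_jordan\<close>)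

lemma I_mult_right: "x \<in> I \<Longrightarrow> y \<in> NC \<Longrightarrow> x * y \<in> I"
  unfolding normalizerC_def I_eq
proof (rule complexification_mult[OF NJ_subspace mult_in_complexification[OF NJ_subspace]])
  fix a b assume a: "a \<in> N \<inter> J" and b: "b \<in> N"
  then show "jordan_prod a b \<in> N \<inter> J" using N_sa by (auto intro: N_jordan_prod J_jordan')
  \<comment> \<open>The normalizer condition has the element of N in the first slot, so the bracket
    is handled in swapped order and its sign is corrected afterwards.\<close>
  have "lie_bracket lam b a \<in> N \<inter> J" using a b by (auto intro: N_lie_bracket N_lie)
  then show "lie_bracket lam a b \<in> N \<inter> J"
    unfolding lie_bracket_swap[of lam a b] by (rule subspace_neg[OF NJ_subspace])
qed

lemma NC_adj: "x \<in> NC \<Longrightarrow> adj x \<in> NC"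
  unfolding normalizerC_def by (rule complexification_adj[OF N_subspace N_sa])

lemma I_adj: "x \<in> I \<Longrightarrow> adj x \<in> I"
  unfolding I_eq by (rule complexification_adj[OF NJ_subspace]) (use N_sa in auto)

lemma NC_space: "complex_space (lin_sub NC)"
  unfolding normalizerC_def
  by (intro lin_sub_complex_space complexification_zero complexification_add
      complexification_scaleC N_subspace)

lemma I_subspace: "complex_subspace (cstar_sub NC) I"
proof -
  interpret complex_space "cstar_sub NC"
    by (rule complex_space_cong[OF NC_space]) (simp_all add: cstar_sub_simps lin_sub_simps)
  show ?thesis
  proof
    show "I \<subseteq> vcarrier (cstar_sub NC)" by (auto simp: reduced_ideal_def cstar_sub_simps)
  qed (auto simp: cstar_sub_simps I_eq intro: complexification_zero[OF NJ_subspace]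
      complexification_add[OF NJ_subspace] complexification_scaleC[OF NJ_subspace])
qed

sublocale I: complex_subspace "cstar_sub NC" I
  by (rule I_subspace)

abbreviation "proj \<equiv> reduced_proj lam J"

lemma proj_eq: "proj x = coset (cstar_sub NC) I x"
  by (simp add: reduced_proj_def)

lemma proj_eq_iff: "x \<in> NC \<Longrightarrow> y \<in> NC \<Longrightarrow> proj x = proj y \<longleftrightarrow> x - y \<in> I"
  using I.coset_eq_iff[of x y]
  by (simp add: proj_eq cstar_sub_simps scaleC_minus_left scaleC_one)

lemma mem_projD:
  assumes "x \<in> NC" "y \<in> proj x"
  shows "y \<in> NC" "y - x \<in> I"
proof -
  show y: "y \<in> NC" using assms I.coset_subset[of x] by (auto simp: proj_eq cstar_sub_simps)
  have "proj y = proj x"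
    using I.coset_eqI[of x y] assms by (simp add: proj_eq cstar_sub_simps)
  then show "y - x \<in> I" using proj_eq_iff y assms(1) by simp
qed

lemma proj_nonempty: "proj x \<noteq> {}"
  by (simp add: proj_eq I.coset_nonempty)

lemma R_simps:
  "vcarrier R = proj ` NC" "vzero R = proj 0"
  "vadd R = vadd (quotient_space (cstar_sub NC) I)"
  "vscale R = vscale (quotient_space (cstar_sub NC) I)"
  "amult R X Y = (\<Union>x\<in>X. \<Union>y\<in>Y. proj (x * y))"
  "aadj R X = (\<Union>x\<in>X. proj (adj x))"
  by (simp_all add: reduced_algebra_def quotient_algebra_def cspace.defs cstar.defs
      quotient_space_def proj_eq cstar_sub_simps)

lemma R_add: "x \<in> NC \<Longrightarrow> y \<in> NC \<Longrightarrow> vadd R (proj x) (proj y) = proj (x + y)"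
  using I.quotient_add[of x y] by (simp add: R_simps proj_eq cstar_sub_simps)

lemma R_scale: "x \<in> NC \<Longrightarrow> vscale R c (proj x) = proj (c *\<^sub>C x)"
  using I.quotient_scale[of x c] by (simp add: R_simps proj_eq cstar_sub_simps)

lemma R_mult:
  assumes x: "x \<in> NC" and y: "y \<in> NC"
  shows "amult R (proj x) (proj y) = proj (x * y)"
proof -
  have "proj (x' * y') = proj (x * y)" if "x' \<in> proj x" "y' \<in> proj y" for x' y'
  proof -
    have 1: "x' \<in> NC" "x' - x \<in> I" "y' \<in> NC" "y' - y \<in> I"
      using mem_projD[OF x that(1)] mem_projD[OF y that(2)] by auto
    have "x' * y' - x * y = (x' - x) * y' + x * (y' - y)" by (simp add: algebra_simps)
    also have "\<dots> \<in> I"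
      using I.sub_add[OF I_mult_right[OF 1(2,3)] I_mult_left[OF x 1(4)]]
      by (simp add: cstar_sub_simps)
    finally show ?thesis using proj_eq_iff NC_mult x y 1 by simp
  qed
  then show ?thesis by (simp add: R_simps proj_nonempty)
qed

lemma R_adj:
  assumes x: "x \<in> NC"
  shows "aadj R (proj x) = proj (adj x)"
proof -
  have "proj (adj x') = proj (adj x)" if "x' \<in> proj x" for x'
    using mem_projD[OF x that] I_adj[of "x' - x"] x by (simp add: proj_eq_iff NC_adj adj_diff)
  then show ?thesis by (simp add: R_simps proj_nonempty)
qed

lemma R_space: "complex_space R"
  by (rule complex_space_cong[OF I.quotient_complex_space])
    (simp_all add: R_simps quotient_space_def proj_eq cstar_sub_simps)

lemma sum_subspace: "subspace (N + J)"
proof -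
  have "N + J = {x + y | x y. x \<in> N \<and> y \<in> J}" by (auto simp: set_plus_def)
  then show ?thesis using subspace_sums[OF N_subspace J_subspace] by simp
qed

lemma sumC_space: "complex_space (lin_sub (sumC lam J))"
  unfolding sumC_def
  by (intro lin_sub_complex_space complexification_zero complexification_add
      complexification_scaleC sum_subspace)

lemma NC_subset_sumC: "NC \<subseteq> sumC lam J"
proof -
  have "N \<subseteq> N + J" using subspace_0[OF J_subspace] set_plus_intro[of _ N 0 J] by fastforce
  then show ?thesis by (auto simp: normalizerC_def sumC_def complexification_def)
qed

lemma sumC_decomp:
  assumes "x \<in> sumC lam J"
  obtains n j where "n \<in> NC" "j \<in> complexification J" "x = n + j"
proof -
  obtain a b where "a \<in> N + J" "b \<in> N + J" "x = a + \<i> *\<^sub>C b"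
    using assms unfolding sumC_def by (rule complexificationE)
  then obtain n1 j1 n2 j2 where *: "n1 \<in> N" "j1 \<in> J" "n2 \<in> N" "j2 \<in> J"
      "x = (n1 + j1) + \<i> *\<^sub>C (n2 + j2)"
    by (auto elim!: set_plus_elim)
  then have "x = (n1 + \<i> *\<^sub>C n2) + (j1 + \<i> *\<^sub>C j2)" by (simp add: scaleC_add_right)
  then show ?thesis
    using that complexificationI * unfolding normalizerC_def by metis
qed

end

section \<open>The forms of the two states and the isometry between their quotients\<close>

locale reduced_state = jordan_reduction +
  fixes \<omega>t :: "'a set \<Rightarrow> complex" and \<omega> :: "'a \<Rightarrow> complex"
  assumes \<omega>t: "state R \<omega>t" and \<omega>: "state (cstar_sub UNIV) \<omega>"
    and \<omega>_proj: "x \<in> NC \<Longrightarrow> \<omega> x = \<omega>t (proj x)"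
begin

abbreviation form :: "'a \<Rightarrow> 'a \<Rightarrow> complex" where
  "form \<equiv> \<lambda>x y. \<omega> (adj x * y)"

abbreviation R_form :: "'a set \<Rightarrow> 'a set \<Rightarrow> complex" where
  "R_form \<equiv> \<lambda>X Y. \<omega>t (amult R (aadj R X) Y)"

lemma UNIV_semi_inner: "semi_inner_space (lin_sub UNIV) form"
  by (intro state_semi_inner lin_sub_complex_space \<omega>) auto

text \<open>\<open>A.null\<close> is the Gelfand ideal of \<omega> in the whole algebra. Null
  elements from the complexification of J and from \<open>I\<close> are combined there before
  restriction to \<open>sumC lam J\<close>.\<close>

sublocale A: semi_inner_space "lin_sub UNIV" form
  by (rule UNIV_semi_inner)

lemma sum_semi_inner: "semi_inner_space (lin_sub (sumC lam J)) form"
  by (intro state_semi_inner sumC_space \<omega>)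

sublocale S: semi_inner_space "lin_sub (sumC lam J)" form
  by (rule sum_semi_inner)

text \<open>Since the projection respects products and adjoints, the GNS form pulls back to the form
  of \<omega>. Every question about \<open>R_form\<close> thus becomes one about representatives in
  \<open>NC\<close>.\<close>

lemma R_form_proj: "x \<in> NC \<Longrightarrow> y \<in> NC \<Longrightarrow> R_form (proj x) (proj y) = form x y"
  by (simp add: R_adj R_mult NC_adj NC_mult \<omega>_proj)

lemma R_semi_inner: "semi_inner_space R R_form"
proof -
  interpret NC: semi_inner_space "lin_sub NC" form by (intro state_semi_inner NC_space \<omega>)
  note NC_facts = NC.form_add NC.form_scale NC.form_nonneg NC.closed_simps
  interpret complex_space R by (rule R_space)
  show ?thesis
    by unfold_locales
      (use NC_facts in \<open>auto simp: R_simps(1) R_add R_scale R_form_proj lin_sub_simps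
        intro: NC.form_cnj[unfolded lin_sub_simps]\<close>)
qed

sublocale RS: semi_inner_space R R_form
  by (rule R_semi_inner)

lemma \<omega>_ideal:
  assumes "x \<in> I"
  shows "\<omega> x = 0"
proof -
  have xN: "x \<in> NC" and zN: "0 \<in> NC"
    using assms I.zero_closed by (auto simp: reduced_ideal_def cstar_sub_simps)
  have "\<omega> x = \<omega>t (proj 0)" using \<omega>_proj[OF xN] proj_eq_iff[OF xN zN] assms by simp
  also have "\<omega> 0 = 0" using \<omega> by (auto simp: state_def cstar_sub_simps dest: spec[of _ 0])
  ultimately show ?thesis using \<omega>_proj[OF zN] by simp
qed

lemma A_null_iff: "x \<in> A.null \<longleftrightarrow> form x x = 0"
  by (simp add: A.null_def lin_sub_simps)

lemma J_null: "complexification J \<subseteq> A.null"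
proof
  have J0: "j \<in> A.null" if "j \<in> J" for j
  proof -
    have j: "j \<in> selfadjoint" using that J_sa by auto
    have "jordan_prod j j \<in> N \<inter> J" using jordan_square_in_N J_jordan j that by auto
    then have "jordan_prod j j \<in> I" unfolding I_eq by (rule complexification_incl[OF NJ_subspace])
    moreover have "jordan_prod j j = adj j * j"
      using j by (simp add: jordan_prod_def selfadjoint_def scaleR_2[symmetric])
    ultimately show ?thesis using \<omega>_ideal by (simp add: A_null_iff)
  qed
  fix x assume "x \<in> complexification J"
  then obtain a b where ab: "a \<in> J" "b \<in> J" "x = a + \<i> *\<^sub>C b" by (rule complexificationE)
  show "x \<in> A.null"
    \<comment> \<open>The square argument treats only self-adjoint elements; closure of the null
      vectors under sums and complex multiples handles a + i b.\<close>
    using A.null.sub_add[OF J0[OF ab(1)] A.null.sub_scale[OF J0[OF ab(2)], of \<i>]]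
    by (simp add: ab(3) lin_sub_simps)
qed

lemma sum_null_eq: "sum_null lam J \<omega> = S.null"
  by (auto simp: sum_null_def gelfand_ideal_def cstar_sub_simps S.null_def lin_sub_simps)

lemma gelfand_ideal_eq: "gelfand_ideal R \<omega>t = RS.null"
  by (simp add: gelfand_ideal_def RS.null_def)

lemma sum_pre_hilbert_eq: "sum_pre_hilbert lam J \<omega> = S.hquot"
  by (simp add: sum_pre_hilbert_def sum_null_eq)

lemma gns_space_eq: "gns_space R \<omega>t = ip_completion RS.hquot"
  by (simp add: gns_space_def gelfand_ideal_eq)

text \<open>The underlying map picks a representative in \<open>NC\<close> for each coset in
  \<open>R\<close>. The choice is arbitrary, because two representatives differ by an element of
  \<open>I\<close>, which is null for \<omega>.\<close>

lemma quotient_unitary: "\<exists>U. unitary_map RS.hquot S.hquot U"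
proof (rule quotient_unitary_map[OF R_semi_inner sum_semi_inner])
  define rep where "rep X = (SOME x. x \<in> NC \<and> proj x = X)" for X
  have rep: "rep X \<in> NC" "proj (rep X) = X" if "X \<in> vcarrier R" for X
  proof -
    have "\<exists>x. x \<in> NC \<and> proj x = X" using that by (auto simp: R_simps)
    then have "rep X \<in> NC \<and> proj (rep X) = X" unfolding rep_def by (rule someI_ex)
    then show "rep X \<in> NC" "proj (rep X) = X" by auto
  qed
  show "rep X \<in> vcarrier (lin_sub (sumC lam J))" if "X \<in> vcarrier R" for X
    using rep(1)[OF that] NC_subset_sumC by (auto simp: lin_sub_simps)
  show "form (rep X) (rep Y) = R_form X Y" if "X \<in> vcarrier R" "Y \<in> vcarrier R" for X Y
    using R_form_proj[of "rep X" "rep Y"] rep[OF that(1)] rep[OF that(2)] by simp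
  fix y assume "y \<in> vcarrier (lin_sub (sumC lam J))"
  then have y: "y \<in> sumC lam J" by (simp add: lin_sub_simps)
  then obtain n j where nj: "n \<in> NC" "j \<in> complexification J" "y = n + j" by (rule sumC_decomp)
  have pn: "proj n \<in> vcarrier R" using nj by (simp add: R_simps)
  note r = rep[OF pn]
  \<comment> \<open>For y = n + j the coset of n is the preimage sought: rep (proj n) - y splits
    into rep (proj n) - n, which lies in \<open>I\<close> and so in the complexification of J, and
    -j. Both are null.\<close>
  have "rep (proj n) - n \<in> A.null"
    using proj_eq_iff[OF r(1) nj(1)] r(2) J_null by (auto simp: reduced_ideal_def)
  moreover have "- j \<in> A.null"
    using A.null.sub_scale[of j "-1"] nj(2) J_null
    by (auto simp: lin_sub_simps scaleC_minus_left scaleC_one)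
  ultimately have "(rep (proj n) - n) + (- j) \<in> A.null"
    using A.null.sub_add by (fastforce simp: lin_sub_simps)
  then have 1: "rep (proj n) - y \<in> A.null" by (simp add: nj(3) algebra_simps)
  have "rep (proj n) \<in> sumC lam J" using r NC_subset_sumC by auto
  then have "rep (proj n) - y \<in> sumC lam J"
    using S.closed_simps(1)[OF _ S.closed_simps(3)[of y "-1"], of "rep (proj n)"] y
    by (simp add: lin_sub_simps scaleC_minus_left scaleC_one)
  with 1 have "S.vsub (rep (proj n)) y \<in> S.null"
    by (simp add: S.null_def A_null_iff lin_sub_simps scaleC_minus_left scaleC_one)
  then show "\<exists>X\<in>vcarrier R. S.vsub (rep X) y \<in> S.null" using pn by blast
qed

end

theorem theorem9:
  fixes lam :: real
    and J :: "'a::unital_cstar_algebra set"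
    and \<omega>t :: "'a set \<Rightarrow> complex"
    and \<omega>' \<omega> :: "'a \<Rightarrow> complex"
  assumes "lam \<noteq> 0"
    and "jordan_ideal J"
    and "closedin (top_of_set selfadjoint) J"
    and "state (reduced_algebra lam J) \<omega>t"
    and "\<forall>A\<in>normalizerC lam J. \<omega>' A = \<omega>t (reduced_proj lam J A)"
    and "state (cstar_sub UNIV) \<omega>"
    and "\<forall>A\<in>normalizerC lam J. \<omega> A = \<omega>' A"
  shows "pre_hilbert_space (sum_pre_hilbert lam J \<omega>) \<and>
    (\<forall>A\<in>sumC lam J. \<forall>B\<in>sumC lam J.
       vip (sum_pre_hilbert lam J \<omega>)
         (coset (lin_sub (sumC lam J)) (sum_null lam J \<omega>) A)
         (coset (lin_sub (sumC lam J)) (sum_null lam J \<omega>) B) = \<omega> (adj A * B)) \<and>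
    unitarily_equivalent (gns_space (reduced_algebra lam J) \<omega>t)
      (ip_completion (sum_pre_hilbert lam J \<omega>))"
proof -
  interpret reduced_state lam J \<omega>t \<omega>
    using assms by unfold_locales simp_all
  have "unitarily_equivalent (gns_space (reduced_algebra lam J) \<omega>t)
      (ip_completion (sum_pre_hilbert lam J \<omega>))"
    using quotient_unitary completion_unitarily_equivalent[OF RS.hquot_pre_hilbert S.hquot_pre_hilbert]
    by (auto simp: gns_space_eq sum_pre_hilbert_eq)
  then show ?thesis
    using S.hquot_pre_hilbert S.hquot_ip
    by (simp add: sum_pre_hilbert_eq sum_null_eq lin_sub_simps)
qed

end
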